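(* Let $n,k,s$ be positive integers and let $\mathcal F\subset[n]^k$ with $|\mathcal F|=(s-1)n^{k-1}+1$. Let $\mathcal M$ be a uniformly random perfect matching of $[n]^k$, let $\xi_{\mathcal F}=|\mathcal F\cap\mathcal M|$, and put $p_{\mathcal F}=\mathbb P[\xi_{\mathcal F}\neq s-1]$. Call a hyperplane $\mathcal H_i(a)$ $\mathcal F$-fat if $|\mathcal H_i(a)\cap\mathcal F|\geq(1-2p_{\mathcal F})n^{k-1}$ and $\mathcal F$-thin if $|\mathcal H_i(a)\cap\mathcal F|\leq 2p_{\mathcal F}n^{k-1}$. <ol> <li>Suppose $n\geq 4$ and $p_{\mathcal F}<1/8$, and fix $i\in[k]$. Then one of the following holds: (a) for every $a\in[n]$, $|\mathcal H_i(a)\cap\mathcal F|\leq 2p_{\mathcal F}n^{k-1}+(s-1)n^{k-2}$; or (b) there is a partition $[n]=F\sqcup T$ such that $\mathcal H_i(a)$ is $\mathcal F$-fat for every $a\in F$ and $\mathcal H_i(a)$ is $\mathcal F$-thin for every $a\in T$.</li> <li>Suppose $n\geq 8$, $s\geq 3$ and $p_{\mathcal F}\leq\frac{1}{4n(s-1)}$. Then all $\mathcal F$-fat hyperplanes are parallel, i.e., there is a fixed $i\in[k]$ such that every $\mathcal F$-fat hyperplane is of the form $\mathcal H_i(a)$ for some $a\in[n]$.</li> <li>Suppose $n\geq 8$, $s\geq 3$ and $p_{\mathcal F}\leq\frac{1}{4n(s-1)}$. Then there are exactly $s-1$ $\mathcal F$-fat hyperplanes.</li> </ol>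
   Context: $[n]=\{1,\ldots,n\}$ and $[n]^k$ is the set of all $k$-tuples $\mathbf x=(x_1,\ldots,x_k)$ with $x_j\in[n]$. Two tuples $\mathbf x,\mathbf y$ are disjoint iff $x_j\neq y_j$ for all $j\in[k]$. A perfect matching of $[n]^k$ is a collection of $n$ pairwise disjoint tuples in $[n]^k$ (equivalently, viewing tuples as the sets $\{(j,x_j)\}\subset[k]\times[n]$, $n$ disjoint sets covering $[k]\times[n]$). For $i\in[k]$ and $a\in[n]$, the hyperplane $\mathcal H_i(a)$ is $\{\mathbf x\in[n]^k: x_i=a\}$. *)

theory Defs
  imports "HOL-Probability.Probability"
begin

definition tuples :: "nat \<Rightarrow> nat \<Rightarrow> (nat \<Rightarrow> nat) set" where
  "tuples n k = {1..k} \<rightarrow>\<^sub>E {1..n}"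

definition disjoint_tuples :: "nat \<Rightarrow> (nat \<Rightarrow> nat) \<Rightarrow> (nat \<Rightarrow> nat) \<Rightarrow> bool" where
  "disjoint_tuples k x y \<longleftrightarrow> (\<forall>j\<in>{1..k}. x j \<noteq> y j)"

definition perfect_matching :: "nat \<Rightarrow> nat \<Rightarrow> (nat \<Rightarrow> nat) set \<Rightarrow> bool" where
  "perfect_matching n k M \<longleftrightarrow>
     M \<subseteq> tuples n k \<and> card M = n \<and> pairwise (disjoint_tuples k) M"

definition random_matching :: "nat \<Rightarrow> nat \<Rightarrow> (nat \<Rightarrow> nat) set pmf" where
  "random_matching n k = pmf_of_set {M. perfect_matching n k M}"

text \<open>
  The set on which \<^const>\<open>random_matching\<close> is uniform is finite and nonempty, so that
  \<^const>\<open>pmf_of_set\<close> really denotes the uniform distribution on it.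
\<close>

lemma finite_perfect_matchings: "finite {M. perfect_matching n k M}"
proof (rule finite_subset)
  show "{M. perfect_matching n k M} \<subseteq> Pow (tuples n k)"
    by (auto simp: perfect_matching_def)
  show "finite (Pow (tuples n k))"
    by (simp add: tuples_def finite_PiE)
qed

lemma perfect_matchings_nonempty:
  assumes "k \<ge> 1"
  shows "{M. perfect_matching n k M} \<noteq> {}"
proof -
  define c :: "nat \<Rightarrow> nat \<Rightarrow> nat" where "c = (\<lambda>a. \<lambda>j\<in>{1..k}. a)"
  have c: "c a j = a" if "j \<in> {1..k}" for a j
    using that by (simp add: c_def)
  have "inj_on c {1..n}"
  proof (rule inj_onI)
    fix a b assume "c a = c b"
    then show "a = b" using c[of 1 a] c[of 1 b] assms by simp
  qed
  then have "card (c ` {1..n}) = n" by (simp add: card_image)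
  moreover have "c ` {1..n} \<subseteq> tuples n k"
    by (auto simp: tuples_def c_def)
  moreover have "pairwise (disjoint_tuples k) (c ` {1..n})"
    by (auto simp: pairwise_def disjoint_tuples_def c)
  ultimately show ?thesis unfolding perfect_matching_def by blast
qed

definition xi :: "(nat \<Rightarrow> nat) set \<Rightarrow> (nat \<Rightarrow> nat) set \<Rightarrow> nat" where
  "xi \<F> M = card (\<F> \<inter> M)"

definition p_fail :: "nat \<Rightarrow> nat \<Rightarrow> nat \<Rightarrow> (nat \<Rightarrow> nat) set \<Rightarrow> real" where
  "p_fail n k s \<F> = measure_pmf.prob (random_matching n k) {M. xi \<F> M \<noteq> s - 1}"

definition hyperplane :: "nat \<Rightarrow> nat \<Rightarrow> nat \<Rightarrow> nat \<Rightarrow> (nat \<Rightarrow> nat) set" where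
  "hyperplane n k i a = {x \<in> tuples n k. x i = a}"

definition hyperplanes :: "nat \<Rightarrow> nat \<Rightarrow> (nat \<Rightarrow> nat) set set" where
  "hyperplanes n k = {hyperplane n k i a | i a. i \<in> {1..k} \<and> a \<in> {1..n}}"

definition fat :: "nat \<Rightarrow> nat \<Rightarrow> nat \<Rightarrow> (nat \<Rightarrow> nat) set \<Rightarrow> (nat \<Rightarrow> nat) set \<Rightarrow> bool" where
  "fat n k s \<F> H \<longleftrightarrow>
     real (card (H \<inter> \<F>)) \<ge> (1 - 2 * p_fail n k s \<F>) * real n ^ (k - 1)"

definition thin :: "nat \<Rightarrow> nat \<Rightarrow> nat \<Rightarrow> (nat \<Rightarrow> nat) set \<Rightarrow> (nat \<Rightarrow> nat) set \<Rightarrow> bool" where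
  "thin n k s \<F> H \<longleftrightarrow>
     real (card (H \<inter> \<F>)) \<le> 2 * p_fail n k s \<F> * real n ^ (k - 1)"

end

theory Submission
  imports Defs
begin

text \<open>
  Write \<open>r = s - 1\<close> and let \<open>p\<close> be the probability that a random matching does not meet the
  family in exactly \<open>r\<close> tuples. Exchanging the \<open>i\<close>-coordinates \<open>a\<close> and \<open>b\<close> in a random matching
  shows that \<open>g = f\<^sub>a - f\<^sub>b\<close>, the difference of the indicators of two parallel slices, takes equal
  values at a random pair of disjoint tuples with probability at least \<open>1 - 2p\<close>. The disjointness
  graph is a tensor power of a complete graph and has spectral gap at least \<open>1 - 1/(n - 1)\<close>, so \<open>g\<close> is
  constant up to density \<open>2p\<close>. Hence either all slices are nearly equal, or each is fat or thin;
  double counting then gives the exact number of fat slices in a direction that has one.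

  If there is no fat hyperplane at all, every coordinate has influence at most \<open>2p\<close>. Split the
  coordinates into \<open>S = {1..l}\<close> and the rest, and let \<open>a(u)\<close> be the density of the section of the
  family over \<open>u\<close> on \<open>S\<close>. The dichotomy, applied to the sections over the \<open>n\<close> points of a random
  matching of the \<open>S\<close>-cube, says that these densities are all close to \<open>r/n\<close> or all close to
  \<open>{0, 1}\<close>. Their average distance from \<open>{0, 1}\<close> therefore has two modes, whereas pairwise
  near-independence makes it concentrate around its mean. As \<open>l\<close> increases from \<open>0\<close> to \<open>k\<close> this mean
  moves from one mode to the other in steps of size at most \<open>2p\<close>, so for some \<open>l\<close> it lies strictly
  between them, a contradiction.
\<close>

section \<open>Averages over finite sets\<close>

text \<open>Expectation under the uniform distribution. Division by zero makes it 0 on empty and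
  infinite sets, so linearity and exchange of averages need no side conditions.\<close>

definition avg :: "'a set \<Rightarrow> ('a \<Rightarrow> real) \<Rightarrow> real" where
  "avg A f = (\<Sum>x\<in>A. f x) / real (card A)"

lemma avg_cong: "(\<And>x. x \<in> A \<Longrightarrow> f x = g x) \<Longrightarrow> avg A f = avg A g"
  unfolding avg_def by (simp cong: sum.cong)

lemma avg_add: "avg A (\<lambda>x. f x + g x) = avg A f + avg A g"
  by (simp add: avg_def sum.distrib add_divide_distrib)

lemma avg_diff: "avg A (\<lambda>x. f x - g x) = avg A f - avg A g"
  by (simp add: avg_def sum_subtractf diff_divide_distrib)

lemma avg_cmult: "avg A (\<lambda>x. c * f x) = c * avg A f"
  by (simp add: avg_def sum_distrib_left)

lemma avg_multc: "avg A (\<lambda>x. f x * c) = avg A f * c"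
  by (simp add: avg_def sum_distrib_right)

lemma avg_sum: "avg A (\<lambda>x. \<Sum>i\<in>I. f i x) = (\<Sum>i\<in>I. avg A (f i))"
  unfolding avg_def by (subst sum.swap) (simp add: sum_divide_distrib)

lemma avg_const: "finite A \<Longrightarrow> A \<noteq> {} \<Longrightarrow> avg A (\<lambda>_. c) = c"
  by (simp add: avg_def)

lemma avg_mono: "(\<And>x. x \<in> A \<Longrightarrow> f x \<le> g x) \<Longrightarrow> avg A f \<le> avg A g"
  unfolding avg_def by (intro divide_right_mono sum_mono) auto

lemma avg_nonneg: "(\<And>x. x \<in> A \<Longrightarrow> 0 \<le> f x) \<Longrightarrow> 0 \<le> avg A f"
  unfolding avg_def by (intro divide_nonneg_nonneg sum_nonneg) auto

lemma avg_abs: "\<bar>avg A f\<bar> \<le> avg A (\<lambda>x. \<bar>f x\<bar>)"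
  unfolding avg_def by (simp add: divide_right_mono)

lemma avg_swap: "avg A (\<lambda>x. avg B (f x)) = avg B (\<lambda>y. avg A (\<lambda>x. f x y))"
proof -
  have "(\<Sum>x\<in>A. \<Sum>y\<in>B. f x y) = (\<Sum>y\<in>B. \<Sum>x\<in>A. f x y)"
    by (rule sum.swap)
  then show ?thesis
    by (simp add: avg_def sum_divide_distrib[symmetric] field_simps)
qed

lemma avg_bij: "bij_betw \<phi> A B \<Longrightarrow> avg A (\<lambda>x. f (\<phi> x)) = avg B f"
  unfolding avg_def by (simp add: bij_betw_same_card sum.reindex_bij_betw)

lemma avg_fibres:
  assumes "finite A" "\<phi> ` A = B" "c > 0" "\<And>y. y \<in> B \<Longrightarrow> card {x \<in> A. \<phi> x = y} = c"
  shows "avg A (\<lambda>x. f (\<phi> x)) = avg B f"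
proof -
  have s: "(\<Sum>x\<in>A. g (\<phi> x)) = real c * (\<Sum>y\<in>B. g y)" for g :: "'b \<Rightarrow> real"
  proof -
    have "(\<Sum>x\<in>A. g (\<phi> x)) = (\<Sum>y\<in>B. \<Sum>x\<in>{x \<in> A. \<phi> x = y}. g (\<phi> x))"
      using sum.image_gen[OF assms(1), of "\<lambda>x. g (\<phi> x)" \<phi>] assms(2) by simp
    also have "\<dots> = (\<Sum>y\<in>B. real c * g y)"
      using assms(4) by (intro sum.cong) auto
    finally show ?thesis by (simp add: sum_distrib_left)
  qed
  from s[of "\<lambda>_. 1"] have "real (card A) = real c * real (card B)" by simp
  with s[of f] assms(3) show ?thesis by (simp add: avg_def)
qed

lemma avg_PiE_insert:
  assumes "j \<notin> J"
  shows "avg (insert j J \<rightarrow>\<^sub>E A) f = avg A (\<lambda>a. avg (J \<rightarrow>\<^sub>E A) (\<lambda>v. f (v(j := a))))"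
proof -
  have inj: "inj_on (\<lambda>(a, v). v(j := a)) (A \<times> (J \<rightarrow>\<^sub>E A))"
    using inj_combinator[OF assms, of "\<lambda>_. A"] .
  have im: "(insert j J \<rightarrow>\<^sub>E A) = (\<lambda>(a, v). v(j := a)) ` (A \<times> (J \<rightarrow>\<^sub>E A))"
    by (rule PiE_insert_eq)
  have "(\<Sum>v\<in>insert j J \<rightarrow>\<^sub>E A. f v) = (\<Sum>a\<in>A. \<Sum>v\<in>J \<rightarrow>\<^sub>E A. f (v(j := a)))"
    by (subst im, subst sum.reindex[OF inj])
      (simp add: sum.cartesian_product case_prod_unfold del: fun_upd_apply)
  moreover have "card (insert j J \<rightarrow>\<^sub>E A) = card A * card (J \<rightarrow>\<^sub>E A)"
    by (simp add: im card_image[OF inj] card_cartesian_product)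
  ultimately show ?thesis
    by (simp add: avg_def sum_divide_distrib[symmetric] field_simps del: fun_upd_apply)
qed

text \<open>Glues a point over \<open>S\<close> to a point off \<open>S\<close>. The value type
  stays general because the same gluing serves tuples and arrays of permutations.\<close>

definition join :: "'a set \<Rightarrow> ('a \<Rightarrow> 'b) \<Rightarrow> ('a \<Rightarrow> 'b) \<Rightarrow> 'a \<Rightarrow> 'b" where
  "join S u v = (\<lambda>j. if j \<in> S then u j else v j)"

lemma join_empty [simp]: "join {} u v = v"
  by (simp add: join_def)

lemma avg_PiE_Un:
  assumes "finite S" "S \<inter> J = {}"
  shows "avg (S \<union> J \<rightarrow>\<^sub>E A) f = avg (S \<rightarrow>\<^sub>E A) (\<lambda>u. avg (J \<rightarrow>\<^sub>E A) (\<lambda>v. f (join S u v)))"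
  using assms
proof (induction S arbitrary: f rule: finite_induct)
  case empty
  then show ?case by (simp add: avg_def)
next
  case (insert i S)
  have j: "(join S u v)(i := a) = join (insert i S) (u(i := a)) v" for u v and a :: 'b
    by (auto simp: join_def)
  have "i \<notin> S \<union> J" "S \<inter> J = {}" using insert by auto
  then show ?case
    unfolding Un_insert_left avg_PiE_insert[OF \<open>i \<notin> S \<union> J\<close>] avg_PiE_insert[OF insert.hyps(2)]
    by (simp only: insert.IH j)
qed

section \<open>Random permutations and the disjointness graph\<close>

text \<open>Precomposition with a transposition shows that the left side does not depend on
  \<open>t\<close>. Averaging it over all \<open>t\<close> and exchanging averages leaves, for each
  permutation, the average of \<open>g\<close> over \<open>A\<close>.\<close>

lemma avg_permutes_1:
  assumes "finite A" "t \<in> A"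
  shows "avg {\<sigma>. \<sigma> permutes A} (\<lambda>\<sigma>. g (\<sigma> t)) = avg A g"
proof -
  let ?P = "{\<sigma>. \<sigma> permutes A}"
  have ne: "finite ?P" "?P \<noteq> {}"
    using finite_permutations[OF assms(1)] permutes_id by blast+
  have fine: "A \<noteq> {}" using assms by auto
  have eq: "avg ?P (\<lambda>\<sigma>. g (\<sigma> s)) = avg ?P (\<lambda>\<sigma>. g (\<sigma> t))" if "s \<in> A" for s
  proof -
    have "Transposition.transpose s t permutes A" using that assms by (simp add: permutes_swap_id)
    then have "bij_betw (\<lambda>\<sigma>. \<sigma> \<circ> Transposition.transpose s t) ?P ?P"
      by (intro bij_betw_byWitness[where f' = "\<lambda>\<sigma>. \<sigma> \<circ> Transposition.transpose s t"])
        (auto simp: o_assoc[symmetric] intro: permutes_compose)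
    from avg_bij[OF this, of "\<lambda>\<sigma>. g (\<sigma> s)"] show ?thesis by simp
  qed
  have "avg A (\<lambda>s. avg ?P (\<lambda>\<sigma>. g (\<sigma> s))) = avg A (\<lambda>_. avg ?P (\<lambda>\<sigma>. g (\<sigma> t)))"
    by (intro avg_cong eq)
  then have "avg ?P (\<lambda>\<sigma>. g (\<sigma> t)) = avg A (\<lambda>s. avg ?P (\<lambda>\<sigma>. g (\<sigma> s)))"
    using fine assms(1) by (simp add: avg_const)
  also have "\<dots> = avg ?P (\<lambda>\<sigma>. avg A (\<lambda>s. g (\<sigma> s)))"
    by (rule avg_swap)
  also have "\<dots> = avg ?P (\<lambda>\<sigma>. avg A g)"
    by (intro avg_cong avg_bij) (auto intro: permutes_imp_bij)
  finally show ?thesis using ne by (simp add: avg_const)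
qed

lemma permutes_2_transitive:
  assumes "s \<in> A" "s' \<in> A" "s \<noteq> s'" "t \<in> A" "t' \<in> A" "t \<noteq> t'"
  obtains \<tau> where "\<tau> permutes A" "\<tau> s = t" "\<tau> s' = t'"
proof
  \<comment> \<open>After the first swap \<open>s'\<close> sits at \<open>?c\<close>, which differs
    from \<open>t\<close>; the second swap moves it to \<open>t'\<close> and leaves \<open>t\<close>
    alone.\<close>
  let ?c = "Transposition.transpose s t s'"
  show "Transposition.transpose ?c t' \<circ> Transposition.transpose s t permutes A"
    using assms by (intro permutes_compose permutes_swap_id) (auto simp: Transposition.transpose_def)
  show "(Transposition.transpose ?c t' \<circ> Transposition.transpose s t) s = t" "(Transposition.transpose ?c t' \<circ> Transposition.transpose s t) s' = t'"
    using assms by (auto simp: Transposition.transpose_def)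
qed

text \<open>Symmetrisation as for one point, now over ordered pairs of distinct positions: by
  2-transitivity all pairs contribute equally, and each permutation yields the full double sum
  without its diagonal.\<close>

lemma avg_permutes_2:
  assumes "finite A" "t \<in> A" "t' \<in> A" "t \<noteq> t'"
  shows "avg {\<sigma>. \<sigma> permutes A} (\<lambda>\<sigma>. g (\<sigma> t) (\<sigma> t')) * (real (card A) * (real (card A) - 1))
    = (\<Sum>a\<in>A. \<Sum>b\<in>A. g a b) - (\<Sum>a\<in>A. g a a)"
proof -
  let ?P = "{\<sigma>. \<sigma> permutes A}"
  have ne: "finite ?P" "?P \<noteq> {}"
    using finite_permutations[OF assms(1)] permutes_id by blast+
  define e where "e = avg ?P (\<lambda>\<sigma>. g (\<sigma> t) (\<sigma> t'))"
  have eq: "avg ?P (\<lambda>\<sigma>. g (\<sigma> s) (\<sigma> s')) = e" if s: "s \<in> A" "s' \<in> A" "s \<noteq> s'" for s s'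
  proof -
    obtain \<tau> where \<tau>: "\<tau> permutes A" "\<tau> s = t" "\<tau> s' = t'"
      by (rule permutes_2_transitive[of s A s' t t']) (use s assms in auto)
    have "bij_betw (\<lambda>\<sigma>. \<sigma> \<circ> \<tau>) ?P ?P"
      using \<tau>(1) by (intro bij_betw_byWitness[where f' = "\<lambda>\<sigma>. \<sigma> \<circ> inv \<tau>"])
        (auto simp: o_assoc[symmetric] permutes_inv_o intro: permutes_compose permutes_inv)
    from avg_bij[OF this, of "\<lambda>\<sigma>. g (\<sigma> s) (\<sigma> s')"] show ?thesis by (simp add: \<tau> e_def)
  qed
  have "(\<Sum>s\<in>A. \<Sum>s'\<in>A - {s}. avg ?P (\<lambda>\<sigma>. g (\<sigma> s) (\<sigma> s'))) = (\<Sum>s\<in>A. \<Sum>s'\<in>A - {s}. e)"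
    by (intro sum.cong refl eq) auto
  also have "\<dots> = (\<Sum>s\<in>A. (real (card A) - 1) * e)"
  proof (intro sum.cong refl)
    fix s assume "s \<in> A"
    then have "card A \<ge> 1" using assms(1) by (metis One_nat_def Suc_leI card_gt_0_iff empty_iff)
    with \<open>s \<in> A\<close> assms(1) show "(\<Sum>s'\<in>A - {s}. e) = (real (card A) - 1) * e"
      by (simp add: of_nat_diff)
  qed
  also have "\<dots> = e * (real (card A) * (real (card A) - 1))" by simp
  finally have l: "e * (real (card A) * (real (card A) - 1))
      = (\<Sum>s\<in>A. \<Sum>s'\<in>A - {s}. avg ?P (\<lambda>\<sigma>. g (\<sigma> s) (\<sigma> s')))" by simp
  also have "\<dots> = avg ?P (\<lambda>\<sigma>. \<Sum>s\<in>A. \<Sum>s'\<in>A - {s}. g (\<sigma> s) (\<sigma> s'))"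
    by (simp add: avg_sum)
  also have "\<dots> = avg ?P (\<lambda>\<sigma>. (\<Sum>a\<in>A. \<Sum>b\<in>A. g a b) - (\<Sum>a\<in>A. g a a))"
  proof (intro avg_cong)
    fix \<sigma> assume "\<sigma> \<in> ?P"
    then have b: "bij_betw \<sigma> A A" by (auto intro: permutes_imp_bij)
    have "(\<Sum>s\<in>A. \<Sum>s'\<in>A - {s}. g (\<sigma> s) (\<sigma> s')) = (\<Sum>s\<in>A. (\<Sum>s'\<in>A. g (\<sigma> s) (\<sigma> s')) - g (\<sigma> s) (\<sigma> s))"
      using assms(1) by (intro sum.cong) (auto simp: sum_diff1)
    also have "\<dots> = (\<Sum>s\<in>A. (\<Sum>b\<in>A. g (\<sigma> s) b) - g (\<sigma> s) (\<sigma> s))"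
      by (simp add: sum.reindex_bij_betw[OF b])
    also have "\<dots> = (\<Sum>a\<in>A. (\<Sum>b\<in>A. g a b) - g a a)"
      by (rule sum.reindex_bij_betw[OF b])
    finally show "(\<Sum>s\<in>A. \<Sum>s'\<in>A - {s}. g (\<sigma> s) (\<sigma> s')) = (\<Sum>a\<in>A. \<Sum>b\<in>A. g a b) - (\<Sum>a\<in>A. g a a)"
      by (simp add: sum_subtractf)
  qed
  finally show ?thesis using ne by (simp add: e_def avg_const)
qed

text \<open>
  An element \<open>V\<close> of \<open>arr A J\<close> encodes a perfect matching of the cube \<open>J \<rightarrow>\<^sub>E A\<close> whose tuples
  \<open>sel J V t\<close> are labelled by \<open>t \<in> A\<close>.
\<close>

definition arr :: "'a set \<Rightarrow> 'j set \<Rightarrow> ('j \<Rightarrow> 'a \<Rightarrow> 'a) set" where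
  "arr A J = J \<rightarrow>\<^sub>E {\<sigma>. \<sigma> permutes A}"

definition sel :: "'j set \<Rightarrow> ('j \<Rightarrow> 'a \<Rightarrow> 'a) \<Rightarrow> 'a \<Rightarrow> 'j \<Rightarrow> 'a" where
  "sel J V t = (\<lambda>j\<in>J. V j t)"

lemma finite_arr: "finite A \<Longrightarrow> finite J \<Longrightarrow> finite (arr A J)"
  by (simp add: arr_def finite_PiE finite_permutations)

lemma arr_nonempty: "arr A J \<noteq> {}"
proof -
  have "{\<sigma>. \<sigma> permutes A} \<noteq> {}" using permutes_id by blast
  then show ?thesis by (simp add: arr_def PiE_eq_empty_iff)
qed

lemma sel_in_PiE: "V \<in> arr A J \<Longrightarrow> t \<in> A \<Longrightarrow> sel J V t \<in> J \<rightarrow>\<^sub>E A"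
  by (auto simp: sel_def arr_def PiE_mem permutes_in_image dest!: PiE_mem)

lemma sel_insert: "j \<notin> J \<Longrightarrow> sel (insert j J) (V(j := \<sigma>)) t = (sel J V t)(j := \<sigma> t)"
  by (auto simp: sel_def restrict_def)

text \<open>The coordinates of the tuple labelled \<open>t\<close> are independent, and each is
  uniform by \<open>avg_permutes_1\<close>.\<close>

lemma avg_sel:
  assumes "finite J" "finite A" "t \<in> A"
  shows "avg (arr A J) (\<lambda>V. G (sel J V t)) = avg (J \<rightarrow>\<^sub>E A) G"
  using assms(1)
proof (induction J arbitrary: G rule: finite_induct)
  case empty
  then show ?case by (simp add: arr_def avg_def sel_def)
next
  case (insert j J)
  have "avg (arr A (insert j J)) (\<lambda>V. G (sel (insert j J) V t))
      = avg {\<sigma>. \<sigma> permutes A} (\<lambda>\<sigma>. avg (arr A J) (\<lambda>V. G ((sel J V t)(j := \<sigma> t))))"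
    unfolding arr_def avg_PiE_insert[OF insert.hyps(2)] sel_insert[OF insert.hyps(2)] ..
  also have "\<dots> = avg {\<sigma>. \<sigma> permutes A} (\<lambda>\<sigma>. avg (J \<rightarrow>\<^sub>E A) (\<lambda>x. G (x(j := \<sigma> t))))"
    by (intro avg_cong insert.IH)
  also have "\<dots> = avg A (\<lambda>a. avg (J \<rightarrow>\<^sub>E A) (\<lambda>x. G (x(j := a))))"
    by (rule avg_permutes_1[OF assms(2,3)])
  finally show ?case unfolding avg_PiE_insert[OF insert.hyps(2)] .
qed

section \<open>Spectral gap of the disjointness graph\<close>

text \<open>
  Only the trivial bound \<open>B g g \<ge> - avg g\<^sup>2\<close> is needed in the induction: splitting off a coordinate
  turns the form on \<open>h\<close> into the form on the fibre mean \<open>hb\<close> minus \<open>1/(n - 1)\<close> times the mean of the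
  forms on the deviations \<open>d a\<close> from it.
\<close>

lemma avg_sel_pair_le:
  fixes h :: "('j \<Rightarrow> 'a) \<Rightarrow> real"
  assumes "finite J" "finite A" "card A \<ge> 2" and t: "t \<in> A" "t' \<in> A" "t \<noteq> t'"
  shows "avg (arr A J) (\<lambda>V. h (sel J V t) * h (sel J V t'))
    \<le> (1 - 1 / (real (card A) - 1)) * (avg (J \<rightarrow>\<^sub>E A) h)\<^sup>2
      + 1 / (real (card A) - 1) * avg (J \<rightarrow>\<^sub>E A) (\<lambda>x. (h x)\<^sup>2)"
  using assms(1)
proof (induction J arbitrary: h rule: finite_induct)
  case empty
  have "sel {} V s = (\<lambda>_. undefined)" for V :: "'j \<Rightarrow> 'a \<Rightarrow> 'a" and s
    by (simp add: sel_def restrict_def)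
  then show ?case by (simp add: arr_def avg_def power2_eq_square algebra_simps)
next
  case (insert j J)
  define n where "n = real (card A)"
  have n: "n \<ge> 2" using assms(3) by (simp add: n_def)
  define B where "B g g' = avg (arr A J) (\<lambda>V. g (sel J V t) * g' (sel J V t'))"
    for g g' :: "('j \<Rightarrow> 'a) \<Rightarrow> real"
  define ha where "ha a x = h (x(j := a))" for a x
  define hb where "hb x = avg A (\<lambda>a. ha a x)" for x
  define d where "d a x = ha a x - hb x" for a x
  have hb: "(\<Sum>a\<in>A. ha a x) = n * hb x" for x
    using n by (simp add: hb_def avg_def n_def)
  let ?X = "J \<rightarrow>\<^sub>E A"
  let ?X' = "insert j J \<rightarrow>\<^sub>E A"
  have B_ge: "B g g \<ge> - avg ?X (\<lambda>x. (g x)\<^sup>2)" for g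
  proof -
    have "0 \<le> avg (arr A J) (\<lambda>V. (g (sel J V t) + g (sel J V t'))\<^sup>2)"
      by (rule avg_nonneg) simp
    also have "\<dots> = avg (arr A J) (\<lambda>V. (g (sel J V t))\<^sup>2) + avg (arr A J) (\<lambda>V. (g (sel J V t'))\<^sup>2)
        + 2 * B g g"
      by (simp add: B_def power2_sum avg_add avg_cmult mult.assoc)
    also have "\<dots> = 2 * avg ?X (\<lambda>x. (g x)\<^sup>2) + 2 * B g g"
      using avg_sel[OF insert.hyps(1) assms(2) t(1), of "\<lambda>x. (g x)\<^sup>2"]
        avg_sel[OF insert.hyps(1) assms(2) t(2), of "\<lambda>x. (g x)\<^sup>2"] by simp
    finally show ?thesis by simp
  qed
  have E: "avg (arr A (insert j J)) (\<lambda>V. h (sel (insert j J) V t) * h (sel (insert j J) V t'))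
      = avg {\<sigma>. \<sigma> permutes A} (\<lambda>\<sigma>. B (ha (\<sigma> t)) (ha (\<sigma> t')))" (is "?E = _")
    unfolding arr_def avg_PiE_insert[OF insert.hyps(2)] sel_insert[OF insert.hyps(2)] B_def ha_def ..
  have 1: "(\<Sum>a\<in>A. \<Sum>b\<in>A. B (ha a) (ha b)) = n\<^sup>2 * B hb hb"
  proof -
    have "(\<Sum>a\<in>A. \<Sum>b\<in>A. ha a x * ha b y) = n\<^sup>2 * (hb x * hb y)" for x y
      using hb[of x] hb[of y] by (simp add: sum_product[symmetric] power2_eq_square)
    then show ?thesis
      by (simp add: B_def avg_sum[symmetric] avg_cmult)
  qed
  have 2: "(\<Sum>a\<in>A. B (d a) (d a)) = (\<Sum>a\<in>A. B (ha a) (ha a)) - n * B hb hb"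
  proof -
    have "(\<Sum>a\<in>A. d a x * d a y) = (\<Sum>a\<in>A. ha a x * ha a y) - n * (hb x * hb y)" for x y
      using hb[of x] hb[of y]
      by (simp add: d_def algebra_simps sum.distrib sum_subtractf sum_distrib_left[symmetric]
          sum_distrib_right[symmetric] n_def[symmetric])
    then show ?thesis
      by (simp add: B_def avg_sum[symmetric] avg_diff avg_cmult)
  qed
  have dd: "(\<Sum>a\<in>A. avg ?X (\<lambda>x. (d a x)\<^sup>2)) = n * avg ?X' (\<lambda>x. (h x)\<^sup>2) - n * avg ?X (\<lambda>x. (hb x)\<^sup>2)"
  proof -
    have "(\<Sum>a\<in>A. (d a x)\<^sup>2) = n * avg A (\<lambda>a. (ha a x)\<^sup>2) - n * (hb x)\<^sup>2" for x
      using hb[of x] n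
      by (simp add: d_def power2_diff sum.distrib sum_subtractf sum_distrib_left[symmetric]
          sum_distrib_right[symmetric] n_def[symmetric] avg_def power2_eq_square algebra_simps)
    then show ?thesis
      using avg_swap[of A ?X "\<lambda>a x. (ha a x)\<^sup>2"]
      by (simp add: avg_sum[symmetric] avg_diff avg_cmult avg_PiE_insert[OF insert.hyps(2)] ha_def
          del: fun_upd_apply)
  qed
  have hbX: "avg ?X hb = avg ?X' h"
    unfolding hb_def avg_PiE_insert[OF insert.hyps(2)] ha_def by (rule avg_swap)
  have IH: "B hb hb \<le> (1 - 1 / (n - 1)) * (avg ?X hb)\<^sup>2 + 1 / (n - 1) * avg ?X (\<lambda>x. (hb x)\<^sup>2)"
    unfolding B_def n_def by (rule insert.IH)
  have "?E * (n * (n - 1)) = n\<^sup>2 * B hb hb - (\<Sum>a\<in>A. B (ha a) (ha a))"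
    using avg_permutes_2[OF assms(2) t, of "\<lambda>a b. B (ha a) (ha b)"]
    unfolding E 1 n_def[symmetric] .
  also have "\<dots> = n * (n - 1) * B hb hb - (\<Sum>a\<in>A. B (d a) (d a))"
    unfolding 2 by (simp add: algebra_simps power2_eq_square)
  also have "\<dots> \<le> n * (n - 1) * B hb hb + (\<Sum>a\<in>A. avg ?X (\<lambda>x. (d a x)\<^sup>2))"
    using sum_mono[of A "\<lambda>a. - avg ?X (\<lambda>x. (d a x)\<^sup>2)" "\<lambda>a. B (d a) (d a)"] B_ge
    by (simp add: sum_negf)
  also have "\<dots> \<le> n * (n - 1) * ((1 - 1 / (n - 1)) * (avg ?X hb)\<^sup>2 + 1 / (n - 1) * avg ?X (\<lambda>x. (hb x)\<^sup>2))
      + (n * avg ?X' (\<lambda>x. (h x)\<^sup>2) - n * avg ?X (\<lambda>x. (hb x)\<^sup>2))"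
    unfolding dd using n IH by (intro add_right_mono mult_left_mono) auto
  also have "\<dots> = ((1 - 1 / (n - 1)) * (avg ?X' h)\<^sup>2 + 1 / (n - 1) * avg ?X' (\<lambda>x. (h x)\<^sup>2)) * (n * (n - 1))"
  proof -
    have "n * m * ((1 - 1 / m) * P + 1 / m * Q) + (n * R - n * Q) = ((1 - 1 / m) * P + 1 / m * R) * (n * m)"
      if "m \<noteq> 0" for m P Q R :: real
      using that by (simp add: field_simps)
    then show ?thesis unfolding hbX using n by simp
  qed
  finally have *: "?E * (n * (n - 1)) \<le> \<dots>" .
  have "n * (n - 1) > 0" using n by simp
  with * show ?case unfolding n_def by (rule mult_right_le_imp_le)
qed

text \<open>
  With \<open>b\<close> the density of the complement of the most frequent value, the spectral gap yields
  \<open>b (1 - b) \<le> 3q/2 < 3/16\<close>; since \<open>3/16 = 1/4 \<cdot> 3/4\<close> this forces \<open>b < 1/4\<close> and then \<open>b \<le> 2q\<close>.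
\<close>

lemma near_constant:
  fixes g :: "('j \<Rightarrow> 'a) \<Rightarrow> real"
  assumes "finite J" "finite A" "card A \<ge> 4" and t: "t \<in> A" "t' \<in> A" "t \<noteq> t'"
    and g: "\<And>x. g x \<in> {-1, 0, 1}"
    and q: "avg (arr A J) (\<lambda>V. of_bool (g (sel J V t) \<noteq> g (sel J V t'))) \<le> 2 * q" "q < 1 / 8"
  obtains c where "c \<in> {-1, 0, 1}" "avg (J \<rightarrow>\<^sub>E A) (\<lambda>x. of_bool (g x \<noteq> c)) \<le> 2 * q"
proof -
  let ?X = "J \<rightarrow>\<^sub>E A"
  have ne: "finite ?X" "?X \<noteq> {}" using assms by (auto simp: finite_PiE PiE_eq_empty_iff)
  define h where "h c x = (of_bool (g x = c) :: real)" for c x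
  define \<alpha> where "\<alpha> c = avg ?X (h c)" for c
  define l where "l = 1 / (real (card A) - 1)"
  have l: "0 \<le> l" "l \<le> 1 / 3" using assms(3) by (auto simp: l_def field_simps)
  let ?C = "{-1, 0, 1 :: real}"
  have \<alpha>0: "0 \<le> \<alpha> c" for c unfolding \<alpha>_def h_def by (rule avg_nonneg) simp
  have h1: "(\<Sum>c\<in>?C. h c x) = 1" for x using g[of x] by (auto simp: h_def)
  have sum1: "(\<Sum>c\<in>?C. \<alpha> c) = 1"
    unfolding \<alpha>_def avg_sum[symmetric] h1 using ne by (simp add: avg_const)
  have pair: "avg (arr A J) (\<lambda>V. h c (sel J V t) * h c (sel J V t')) \<le> (1 - l) * (\<alpha> c)\<^sup>2 + l * \<alpha> c" for c
  proof -
    have "(\<lambda>x. (h c x)\<^sup>2) = h c" by (auto simp: h_def)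
    then show ?thesis
      using avg_sel_pair_le[OF assms(1,2) _ t, of "h c"] assms(3) by (simp add: l_def \<alpha>_def)
  qed
  have "1 - 2 * q \<le> avg (arr A J) (\<lambda>V. 1 - of_bool (g (sel J V t) \<noteq> g (sel J V t')))"
    using q(1) finite_arr[OF assms(2,1)] arr_nonempty[of A J] by (simp add: avg_diff avg_const)
  also have "\<dots> = avg (arr A J) (\<lambda>V. \<Sum>c\<in>?C. h c (sel J V t) * h c (sel J V t'))"
  proof (rule avg_cong)
    fix V
    show "1 - of_bool (g (sel J V t) \<noteq> g (sel J V t')) = (\<Sum>c\<in>?C. h c (sel J V t) * h c (sel J V t'))"
      using g[of "sel J V t"] g[of "sel J V t'"] by (auto simp: h_def)
  qed
  also have "\<dots> \<le> (\<Sum>c\<in>?C. (1 - l) * (\<alpha> c)\<^sup>2 + l * \<alpha> c)"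
    unfolding avg_sum by (intro sum_mono pair)
  also have "\<dots> = l + (1 - l) * (\<Sum>c\<in>?C. (\<alpha> c)\<^sup>2)"
    using sum1 by (simp add: sum.distrib sum_distrib_left[symmetric] del: sum.insert)
  finally have 1: "1 - 2 * q \<le> l + (1 - l) * (\<Sum>c\<in>?C. (\<alpha> c)\<^sup>2)" .
  define m where "m = Max (\<alpha> ` ?C)"
  obtain c where c: "c \<in> ?C" "\<alpha> c = m"
    using Max_in[of "\<alpha> ` ?C"] unfolding m_def by fastforce
  have le: "\<alpha> c' \<le> m" if "c' \<in> ?C" for c'
    unfolding m_def by (rule Max_ge) (use that in auto)
  have m1: "0 \<le> m" "m \<le> 1"
    using \<alpha>0[of "-1"] \<alpha>0[of 0] \<alpha>0[of 1] sum1 c by auto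
  define Q where "Q = (\<Sum>c\<in>?C. (\<alpha> c)\<^sup>2)"
  have "Q \<le> (\<Sum>c\<in>?C. m * \<alpha> c)"
    unfolding Q_def power2_eq_square by (intro sum_mono mult_right_mono le \<alpha>0)
  also have "\<dots> = m" by (simp only: sum_distrib_left[symmetric] sum1)
  finally have Qm: "Q \<le> m" .
  have "Q = m\<^sup>2 + (\<Sum>c'\<in>?C - {c}. (\<alpha> c')\<^sup>2)"
    unfolding Q_def using c by (subst sum.remove[of _ c]) auto
  also have "(\<Sum>c'\<in>?C - {c}. (\<alpha> c')\<^sup>2) \<le> (\<Sum>c'\<in>?C - {c}. \<alpha> c')\<^sup>2"
  proof -
    have "(\<Sum>c'\<in>?C - {c}. (\<alpha> c')\<^sup>2) \<le> (\<Sum>c'\<in>?C - {c}. \<alpha> c' * (\<Sum>c'\<in>?C - {c}. \<alpha> c'))"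
      unfolding power2_eq_square by (intro sum_mono mult_left_mono \<alpha>0 member_le_sum) auto
    then show ?thesis by (simp only: sum_distrib_right[symmetric] power2_eq_square)
  qed
  also have "(\<Sum>c'\<in>?C - {c}. \<alpha> c') = 1 - m"
    using sum1 c by (subst (asm) sum.remove[of _ c]) auto
  finally have Q2: "Q \<le> m\<^sup>2 + (1 - m)\<^sup>2" by simp
  \<comment> \<open>Here \<open>card A \<ge> 4\<close> enters, through \<open>l \<le> 1/3\<close>:
    the spectral bound becomes \<open>2/3 * (1 - Q) \<le> 2 * q\<close>.\<close>
  have "1 / 3 * (1 - Q) \<ge> l * (1 - Q)"
    using l Qm m1 by (intro mult_right_mono) auto
  with 1 have Q3: "Q \<ge> 1 - 3 * q" by (simp add: Q_def[symmetric] algebra_simps)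
  define b where "b = 1 - m"
  \<comment> \<open>The bound \<open>Q \<le> m\<close> keeps \<open>b\<close> below
    \<open>3/4\<close>, which rules out the upper branch of the quadratic inequality
    \<open>b2\<close>.\<close>
  have b: "0 \<le> b" "b < 3 / 8" using m1 Q3 Qm q(2) by (auto simp: b_def)
  have b2: "2 * (b * (1 - b)) \<le> 3 * q"
    using Q2 Q3 by (simp add: b_def power2_eq_square algebra_simps)
  have "b < 1 / 4"
  proof (rule ccontr)
    assume "\<not> b < 1 / 4"
    then have "0 \<le> (b - 1 / 4) * (3 / 4 - b)" using b by (intro mult_nonneg_nonneg) auto
    moreover have "(b - 1 / 4) * (3 / 4 - b) = b * (1 - b) - 3 / 16" by (simp add: field_simps)
    ultimately show False using b2 q(2) by linarith
  qed
  then have "b * (3 / 4) \<le> b * (1 - b)" using b by (intro mult_left_mono) auto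
  with b2 have "b \<le> 2 * q" by simp
  moreover have "avg ?X (\<lambda>x. of_bool (g x \<noteq> c)) = b"
  proof -
    have "(\<lambda>x. of_bool (g x \<noteq> c)) = (\<lambda>x. 1 - h c x)" by (auto simp: h_def)
    then show ?thesis using c ne by (simp add: avg_diff avg_const b_def \<alpha>_def[symmetric])
  qed
  ultimately show ?thesis using that c by auto
qed

section \<open>Exchanging two labels and the dichotomy for slices\<close>

text \<open>Precomposing every row with \<open>\<tau>\<close> permutes the arrays and only renames
  the tuples of the encoded matching.\<close>

lemma avg_arr_relabel:
  assumes "\<tau> permutes A"
  shows "avg (arr A J) (\<lambda>V. f (\<lambda>t. sel J V (\<tau> t))) = avg (arr A J) (\<lambda>V. f (sel J V))"
proof -
  let ?\<phi> = "\<lambda>\<tau> V. \<lambda>j\<in>J. V j \<circ> \<tau>"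
  have in': "?\<phi> \<tau> V \<in> arr A J" if "V \<in> arr A J" "\<tau> permutes A" for V \<tau>
    using that unfolding arr_def by (auto dest: PiE_mem intro: permutes_compose)
  have "bij_betw (?\<phi> \<tau>) (arr A J) (arr A J)"
  proof (rule bij_betw_byWitness[where f' = "?\<phi> (inv \<tau>)"])
    show "\<forall>V\<in>arr A J. ?\<phi> (inv \<tau>) (?\<phi> \<tau> V) = V" "\<forall>V\<in>arr A J. ?\<phi> \<tau> (?\<phi> (inv \<tau>) V) = V"
      using assms by (auto simp: arr_def o_assoc[symmetric] permutes_inv_o PiE_restrict
          cong: restrict_cong)
  qed (use in' assms permutes_inv in auto)
  moreover have "sel J (?\<phi> \<tau> V) = (\<lambda>t. sel J V (\<tau> t))" for V
    by (auto simp: sel_def restrict_def fun_eq_iff)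
  ultimately show ?thesis
    using avg_bij[of "?\<phi> \<tau>" "arr A J" "arr A J" "\<lambda>V. f (sel J V)"] by simp
qed

text \<open>Let \<open>g = F t - F t'\<close>. Exchanging the tuples labelled \<open>t\<close> and
  \<open>t'\<close> changes the sum by a difference of two values of \<open>g\<close>; these agree
  unless one of the two sums misses \<open>r\<close>, which has probability at most
  \<open>2 * q\<close>. Now \<open>near_constant\<close> applies: \<open>c = 0\<close> makes the two
  slices close, \<open>c = 1\<close> or \<open>c = -1\<close> makes one nearly full and the other
  nearly empty.\<close>

lemma rows_dichotomy:
  fixes F :: "'a \<Rightarrow> ('j \<Rightarrow> 'a) \<Rightarrow> real"
  assumes "finite J" "finite A" "card A \<ge> 4" and F: "\<And>t x. F t x \<in> {0, 1}"
    and q: "avg (arr A J) (\<lambda>V. of_bool ((\<Sum>t\<in>A. F t (sel J V t)) \<noteq> r)) \<le> q" "q < 1 / 8"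
  shows "(\<forall>t\<in>A. avg (J \<rightarrow>\<^sub>E A) (F t) \<ge> 1 - 2 * q \<or> avg (J \<rightarrow>\<^sub>E A) (F t) \<le> 2 * q)
    \<or> (\<forall>t\<in>A. \<forall>t'\<in>A. avg (J \<rightarrow>\<^sub>E A) (\<lambda>x. \<bar>F t x - F t' x\<bar>) \<le> 2 * q)"
proof -
  let ?X = "J \<rightarrow>\<^sub>E A"
  have ne: "finite ?X" "?X \<noteq> {}" using assms by (auto simp: finite_PiE PiE_eq_empty_iff)
  define a where "a t = avg ?X (F t)" for t
  define D where "D t t' = avg ?X (\<lambda>x. \<bar>F t x - F t' x\<bar>)" for t t'
  have q0: "0 \<le> q" using q(1) by (rule order_trans[rotated]) (rule avg_nonneg, simp)
  have D0: "D t t \<le> 2 * q" for t using q0 ne by (simp add: D_def avg_const)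
  have Dc: "D t t' = D t' t" for t t' by (simp add: D_def abs_minus_commute)
  have aD: "a t - a t' \<le> D t t'" for t t'
  proof -
    have "avg ?X (\<lambda>x. F t x - F t' x) \<le> D t t'"
      unfolding D_def by (rule avg_mono) simp
    then show ?thesis by (simp add: a_def avg_diff)
  qed
  have pair: "D t t' \<le> 2 * q \<or> (a t \<ge> 1 - 2 * q \<and> a t' \<le> 2 * q) \<or> (a t' \<ge> 1 - 2 * q \<and> a t \<le> 2 * q)"
    if t: "t \<in> A" "t' \<in> A" "t \<noteq> t'" for t t'
  proof -
    define g where "g x = F t x - F t' x" for x
    have g: "g x \<in> {-1, 0, 1}" for x using F[of t x] F[of t' x] by (auto simp: g_def)
    define \<tau> where "\<tau> = Transposition.transpose t t'"
    have \<tau>: "\<tau> permutes A" unfolding \<tau>_def using t by (intro permutes_swap_id)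
    define s where "s v = (\<Sum>t\<in>A. F t (v t))" for v :: "'a \<Rightarrow> 'j \<Rightarrow> 'a"
    have sw: "s (\<lambda>t. v (\<tau> t)) - s v = g (v t') - g (v t)" for v
    proof -
      have A: "(\<Sum>t\<in>A. w t) = w t + (w t' + (\<Sum>t\<in>A - {t, t'}. w t))" for w :: "'a \<Rightarrow> real"
      proof -
        have "A - {t, t'} = A - {t} - {t'}" by auto
        then show ?thesis
          using t assms(2) sum.remove[of A t w] sum.remove[of "A - {t}" t' w] by auto
      qed
      have "(\<Sum>t\<in>A - {t, t'}. F t (v (\<tau> t))) = (\<Sum>t\<in>A - {t, t'}. F t (v t))"
        by (intro sum.cong) (auto simp: \<tau>_def)
      then show ?thesis
        unfolding s_def A by (simp add: \<tau>_def g_def)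
    qed
    have "avg (arr A J) (\<lambda>V. of_bool (g (sel J V t) \<noteq> g (sel J V t')))
        \<le> avg (arr A J) (\<lambda>V. of_bool (s (\<lambda>t. sel J V (\<tau> t)) \<noteq> r) + of_bool (s (sel J V) \<noteq> r))"
    proof (rule avg_mono)
      fix V
      show "of_bool (g (sel J V t) \<noteq> g (sel J V t'))
          \<le> (of_bool (s (\<lambda>t. sel J V (\<tau> t)) \<noteq> r) + of_bool (s (sel J V) \<noteq> r) :: real)"
        using sw[of "sel J V"] by (cases "s (\<lambda>t. sel J V (\<tau> t)) = r"; cases "s (sel J V) = r") auto
    qed
    also have "\<dots> \<le> 2 * q"
      using q(1) avg_arr_relabel[OF \<tau>, of J "\<lambda>v. of_bool (s v \<noteq> r)"]
      by (simp add: avg_add s_def)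
    finally obtain c where c: "c \<in> {-1, 0, 1}" "avg ?X (\<lambda>x. of_bool (g x \<noteq> c)) \<le> 2 * q"
      by (rule near_constant[OF assms(1,2,3) t g _ q(2)])
    have up: "avg ?X w \<le> 2 * q" if "\<And>x. w x \<le> of_bool (g x \<noteq> c)" for w
      by (rule order_trans[OF avg_mono c(2)]) (rule that)
    have lo: "avg ?X w \<ge> 1 - 2 * q" if "\<And>x. 1 - w x \<le> of_bool (g x \<noteq> c)" for w
      using up[of "\<lambda>x. 1 - w x"] that ne by (simp add: avg_diff avg_const)
    consider "c = 0" | "c = 1" | "c = -1" using c(1) by blast
    then show ?thesis
    proof cases
      case 1
      have "D t t' \<le> 2 * q" unfolding D_def
      proof (rule up)
        fix x show "\<bar>F t x - F t' x\<bar> \<le> of_bool (g x \<noteq> c)"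
          using F[of t x] F[of t' x] 1 by (auto simp: g_def)
      qed
      then show ?thesis ..
    next
      case 2
      have "a t \<ge> 1 - 2 * q" unfolding a_def
      proof (rule lo)
        fix x show "1 - F t x \<le> of_bool (g x \<noteq> c)"
          using F[of t x] F[of t' x] 2 by (auto simp: g_def)
      qed
      moreover have "a t' \<le> 2 * q" unfolding a_def
      proof (rule up)
        fix x show "F t' x \<le> of_bool (g x \<noteq> c)"
          using F[of t x] F[of t' x] 2 by (auto simp: g_def)
      qed
      ultimately show ?thesis by blast
    next
      case 3
      have "a t' \<ge> 1 - 2 * q" unfolding a_def
      proof (rule lo)
        fix x show "1 - F t' x \<le> of_bool (g x \<noteq> c)"
          using F[of t x] F[of t' x] 3 by (auto simp: g_def)
      qed
      moreover have "a t \<le> 2 * q" unfolding a_def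
      proof (rule up)
        fix x show "F t x \<le> of_bool (g x \<noteq> c)"
          using F[of t x] F[of t' x] 3 by (auto simp: g_def)
      qed
      ultimately show ?thesis by blast
    qed
  qed
  show ?thesis
  proof (cases "\<forall>t\<in>A. \<forall>t'\<in>A. D t t' \<le> 2 * q")
    case True
    then show ?thesis by (simp add: D_def)
  next
    case False
    \<comment> \<open>A single distant pair forces the first alternative: a slice \<open>d\<close>
      neither nearly full nor nearly empty would be within \<open>2 * q\<close> of both
      \<open>t\<close> and \<open>t'\<close>, whose densities differ by at least
      \<open>1 - 4 * q > 4 * q\<close>.\<close>
    then obtain t0 t1 where t01: "t0 \<in> A" "t1 \<in> A" "\<not> D t0 t1 \<le> 2 * q" by blast
    then have "t0 \<noteq> t1" using D0 by auto
    then consider "a t0 \<ge> 1 - 2 * q" "a t1 \<le> 2 * q" | "a t1 \<ge> 1 - 2 * q" "a t0 \<le> 2 * q"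
      using pair[of t0 t1] t01 by blast
    then obtain t t' where t: "t \<in> A" "t' \<in> A" "a t \<ge> 1 - 2 * q" "a t' \<le> 2 * q"
      using t01 by cases auto
    have "a d \<ge> 1 - 2 * q \<or> a d \<le> 2 * q" if d: "d \<in> A" for d
    proof (rule ccontr)
      assume bad: "\<not> ?thesis"
      then have "d \<noteq> t" "d \<noteq> t'" using t by auto
      with pair[of t d] pair[of d t'] bad d t have "D t d \<le> 2 * q" "D d t' \<le> 2 * q" by blast+
      with aD[of t d] aD[of d t'] t q(2) show False by linarith
    qed
    then show ?thesis by (simp add: a_def)
  qed
qed

section \<open>Labelled matchings and the failure probability\<close>

lemma sel_inj_on: "V \<in> arr A J \<Longrightarrow> j \<in> J \<Longrightarrow> inj_on (sel J V) A"
  by (rule inj_onI, drule fun_cong[where x = j])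
    (auto simp: sel_def arr_def dest!: PiE_mem permutes_inj injD)

lemma perfect_matching_sel:
  assumes "V \<in> arr {1..n} {1..k}" "k \<ge> 1"
  shows "perfect_matching n k (sel {1..k} V ` {1..n})"
  unfolding perfect_matching_def
proof (intro conjI)
  show "sel {1..k} V ` {1..n} \<subseteq> tuples n k"
    unfolding tuples_def using sel_in_PiE[OF assms(1)] by (rule image_subsetI)
  show "card (sel {1..k} V ` {1..n}) = n"
    using sel_inj_on[OF assms(1), of 1] assms(2) by (simp add: card_image)
  show "pairwise (disjoint_tuples k) (sel {1..k} V ` {1..n})"
  proof (rule pairwiseI)
    fix x y assume "x \<in> sel {1..k} V ` {1..n}" "y \<in> sel {1..k} V ` {1..n}" "x \<noteq> y"
    then obtain t t' where t: "x = sel {1..k} V t" "y = sel {1..k} V t'" "t \<noteq> t'" by blast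
    have "V j t \<noteq> V j t'" if "j \<in> {1..k}" for j
    proof -
      have "inj (V j)" using assms(1) that by (auto simp: arr_def dest!: PiE_mem intro: permutes_inj)
      with t(3) show ?thesis by (auto dest: injD)
    qed
    then show "disjoint_tuples k x y" by (simp add: disjoint_tuples_def t(1,2) sel_def)
  qed
qed

text \<open>Disjointness makes the \<open>j\<close>-th coordinates of the tuples pairwise distinct,
  so they run through all of \<open>{1..n}\<close> and form a permutation of the labels.\<close>

lemma perfect_matching_obtain_arr:
  assumes "perfect_matching n k M"
  obtains V where "V \<in> arr {1..n} {1..k}" "sel {1..k} V ` {1..n} = M"
proof -
  have M: "M \<subseteq> tuples n k" "card M = n" "pairwise (disjoint_tuples k) M"
    using assms by (auto simp: perfect_matching_def)
  have "finite M" using M(1) by (rule finite_subset) (simp add: tuples_def finite_PiE)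
  then obtain e where e: "bij_betw e {1..n} M"
    using ex_bij_betw_nat_finite_1 M(2) by blast
  have eM: "e t \<in> M" if "t \<in> {1..n}" for t using e that by (rule bij_betwE[THEN bspec])
  \<comment> \<open>The enumeration \<open>e\<close> supplies the labels. Each row is the identity
    off \<open>{1..n}\<close>, as \<open>permutes\<close> demands.\<close>
  define V where "V = (\<lambda>j\<in>{1..k}. \<lambda>t. if t \<in> {1..n} then e t j else t)"
  have "V j permutes {1..n}" if j: "j \<in> {1..k}" for j
  proof (rule bij_imp_permutes)
    have "inj_on (V j) {1..n}"
    proof (rule inj_onI, rule ccontr)
      fix t t' assume t: "t \<in> {1..n}" "t' \<in> {1..n}" "V j t = V j t'" "t \<noteq> t'"
      then have "e t \<noteq> e t'" using e by (auto simp: bij_betw_def dest: inj_onD)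
      with eM t M(3) have "disjoint_tuples k (e t) (e t')" by (auto dest: pairwiseD)
      with t j show False by (simp add: disjoint_tuples_def V_def)
    qed
    moreover have "V j ` {1..n} \<subseteq> {1..n}"
    proof (rule image_subsetI)
      fix t assume t: "t \<in> {1..n}"
      then have "e t \<in> {1..k} \<rightarrow>\<^sub>E {1..n}" using eM M(1) by (auto simp: tuples_def)
      with t j show "V j t \<in> {1..n}" by (auto simp: V_def dest: PiE_mem)
    qed
    ultimately show "bij_betw (V j) {1..n} {1..n}"
      by (simp add: bij_betw_def endo_inj_surj)
  qed (use j in \<open>auto simp: V_def\<close>)
  then have "V \<in> arr {1..n} {1..k}" by (auto simp: arr_def V_def)
  moreover have "sel {1..k} V t = e t" if t: "t \<in> {1..n}" for t
  proof -
    have "e t \<in> {1..k} \<rightarrow>\<^sub>E {1..n}" using eM[OF t] M(1) by (auto simp: tuples_def)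
    then have "e t = restrict (e t) {1..k}" by (simp add: PiE_restrict)
    also have "\<dots> = sel {1..k} V t" using t by (auto simp: sel_def V_def)
    finally show ?thesis ..
  qed
  then have "sel {1..k} V ` {1..n} = M" using e by (simp add: bij_betw_def)
  ultimately show ?thesis by (rule that)
qed

text \<open>The arrays with a given set of tuples form one orbit under relabelling. The orbit is
  free because the row \<open>V0 j0\<close> is injective, so it is as large as the set of
  permutations of \<open>A\<close>.\<close>

lemma card_arr_fibre:
  fixes V0 :: "'j \<Rightarrow> 'a \<Rightarrow> 'a"
  assumes "finite A" "V0 \<in> arr A J" "j0 \<in> J"
  shows "card {V \<in> arr A J. sel J V ` A = sel J V0 ` A} = fact (card A)"
proof -
  let ?P = "{\<tau>. \<tau> permutes A}"
  define \<phi> where "\<phi> \<tau> = (\<lambda>j\<in>J. V0 j \<circ> \<tau>)" for \<tau> :: "'a \<Rightarrow> 'a"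
  have V0: "V0 j permutes A" if "j \<in> J" for j
    using assms(2) that by (auto simp: arr_def dest: PiE_mem)
  have sel\<phi>: "sel J (\<phi> \<tau>) = (\<lambda>t. sel J V0 (\<tau> t))" for \<tau>
    by (auto simp: sel_def \<phi>_def restrict_def fun_eq_iff)
  have "inj_on \<phi> ?P"
  proof (rule inj_onI)
    fix \<tau> \<tau>' assume "\<phi> \<tau> = \<phi> \<tau>'"
    then have "V0 j0 \<circ> \<tau> = V0 j0 \<circ> \<tau>'" using assms(3) by (auto simp: \<phi>_def dest: fun_cong[where x = j0])
    then show "\<tau> = \<tau>'" using permutes_inj[OF V0[OF assms(3)]] by (simp add: fun.inj_map[THEN injD] inj_eq fun_eq_iff)
  qed
  moreover have "\<phi> ` ?P = {V \<in> arr A J. sel J V ` A = sel J V0 ` A}"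
  proof (intro equalityI subsetI)
    fix V assume "V \<in> \<phi> ` ?P"
    then obtain \<tau> where \<tau>: "\<tau> permutes A" "V = \<phi> \<tau>" by blast
    have "\<phi> \<tau> \<in> arr A J" using V0 \<tau>(1) by (auto simp: arr_def \<phi>_def intro!: permutes_compose)
    moreover have "sel J (\<phi> \<tau>) ` A = sel J V0 ` \<tau> ` A" by (simp add: sel\<phi> image_image)
    ultimately show "V \<in> {V \<in> arr A J. sel J V ` A = sel J V0 ` A}"
      using \<tau> by (simp add: permutes_image)
  next
    fix V assume "V \<in> {V \<in> arr A J. sel J V ` A = sel J V0 ` A}"
    then have V: "V \<in> arr A J" "sel J V ` A = sel J V0 ` A" by auto
    have b0: "bij_betw (sel J V0) A (sel J V0 ` A)" and b: "bij_betw (sel J V) A (sel J V0 ` A)"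
      using sel_inj_on[OF assms(2,3)] sel_inj_on[OF V(1) assms(3)] V(2) by (auto simp: bij_betw_def)
    define \<tau> where "\<tau> t = (if t \<in> A then the_inv_into A (sel J V0) (sel J V t) else t)" for t
    have "bij_betw (the_inv_into A (sel J V0) \<circ> sel J V) A A"
      by (rule bij_betw_trans[OF b bij_betw_the_inv_into[OF b0]])
    then have "bij_betw \<tau> A A"
      by (rule bij_betw_cong[THEN iffD1, rotated]) (simp add: \<tau>_def)
    then have \<tau>: "\<tau> permutes A" by (rule bij_imp_permutes) (simp add: \<tau>_def)
    have s: "sel J V0 (\<tau> t) = sel J V t" if "t \<in> A" for t
      using that b f_the_inv_into_f_bij_betw[OF b0] by (auto simp: \<tau>_def dest: bij_betwE)
    have "V = \<phi> \<tau>"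
    proof
      fix j
      show "V j = \<phi> \<tau> j"
      proof (cases "j \<in> J")
        case True
        have "V j t = V0 j (\<tau> t)" for t
        proof (cases "t \<in> A")
          assume "t \<in> A"
          from fun_cong[OF s[OF this], of j] True show ?thesis by (simp add: sel_def)
        next
          assume t: "t \<notin> A"
          have "V j permutes A" using V(1) True by (auto simp: arr_def dest: PiE_mem)
          with t V0[OF True] show ?thesis by (simp add: \<tau>_def permutes_not_in)
        qed
        then show ?thesis using True by (auto simp: \<phi>_def)
      next
        case False
        then show ?thesis using V(1) by (auto simp: \<phi>_def arr_def dest: PiE_arb)
      qed
    qed
    with \<tau> show "V \<in> \<phi> ` ?P" by blast
  qed
  ultimately have "card ?P = card {V \<in> arr A J. sel J V ` A = sel J V0 ` A}"
    using card_image[of \<phi> ?P] by simp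
  then show ?thesis using card_permutations[OF refl assms(1)] by simp
qed

text \<open>Every perfect matching has exactly \<open>fact n\<close> labellings, so a uniform random
  array encodes a uniform random matching, and its rows are independent random permutations.\<close>

lemma p_fail_eq_avg:
  assumes "k \<ge> 1"
  shows "p_fail n k s \<F> = avg (arr {1..n} {1..k})
    (\<lambda>V. of_bool ((\<Sum>t\<in>{1..n}. of_bool (sel {1..k} V t \<in> \<F>)) \<noteq> real (s - 1)))"
proof -
  let ?PM = "{M. perfect_matching n k M}"
  let ?\<Phi> = "\<lambda>V. sel {1..k} V ` {1..n}"
  have fin: "finite (arr {1..n} {1..k})" by (simp add: finite_arr)
  have im: "?\<Phi> ` arr {1..n} {1..k} = ?PM"
  proof (intro equalityI subsetI)
    fix M assume "M \<in> ?PM"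
    then show "M \<in> ?\<Phi> ` arr {1..n} {1..k}"
      using perfect_matching_obtain_arr[of n k M] by blast
  qed (use perfect_matching_sel assms in auto)
  have c: "card {V \<in> arr {1..n} {1..k}. ?\<Phi> V = M} = fact n" if "M \<in> ?PM" for M
  proof -
    have "M \<in> ?\<Phi> ` arr {1..n} {1..k}" unfolding im by (rule that)
    then obtain V0 where V0: "M = ?\<Phi> V0" "V0 \<in> arr {1..n} {1..k}" by (rule imageE)
    show ?thesis unfolding V0(1) using card_arr_fibre[OF _ V0(2), of 1] assms by simp
  qed
  have xi: "real (xi \<F> (?\<Phi> V)) = (\<Sum>t\<in>{1..n}. of_bool (sel {1..k} V t \<in> \<F>))"
    if "V \<in> arr {1..n} {1..k}" for V
  proof -
    have inj: "inj_on (sel {1..k} V) {1..n}" using sel_inj_on[OF that, of 1] assms by simp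
    have inj': "inj_on (sel {1..k} V) {t \<in> {1..n}. sel {1..k} V t \<in> \<F>}"
      using inj by (rule inj_on_subset) auto
    have "\<F> \<inter> ?\<Phi> V = sel {1..k} V ` {t \<in> {1..n}. sel {1..k} V t \<in> \<F>}" by auto
    then have "xi \<F> (?\<Phi> V) = card {t \<in> {1..n}. sel {1..k} V t \<in> \<F>}"
      by (simp only: xi_def card_image[OF inj'])
    then show ?thesis by (simp add: of_bool_def sum.If_cases Int_def)
  qed
  have "p_fail n k s \<F> = real (card (?PM \<inter> {M. xi \<F> M \<noteq> s - 1})) / real (card ?PM)"
    using perfect_matchings_nonempty[OF assms, of n] finite_perfect_matchings[of n k]
    by (simp add: p_fail_def random_matching_def measure_pmf_of_set)
  also have "\<dots> = avg ?PM (\<lambda>M. of_bool (xi \<F> M \<noteq> s - 1))"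
    using finite_perfect_matchings[of n k]
    by (simp add: avg_def of_bool_def sum.If_cases Int_def)
  also have "\<dots> = avg (arr {1..n} {1..k}) (\<lambda>V. of_bool (xi \<F> (?\<Phi> V) \<noteq> s - 1))"
    by (rule avg_fibres[OF fin im _ c, symmetric]) auto
  also have "\<dots> = avg (arr {1..n} {1..k})
      (\<lambda>V. of_bool ((\<Sum>t\<in>{1..n}. of_bool (sel {1..k} V t \<in> \<F>)) \<noteq> real (s - 1)))"
  proof (rule avg_cong)
    fix V assume "V \<in> arr {1..n} {1..k}"
    from xi[OF this, symmetric]
    show "of_bool (xi \<F> (?\<Phi> V) \<noteq> s - 1)
        = (of_bool ((\<Sum>t\<in>{1..n}. of_bool (sel {1..k} V t \<in> \<F>)) \<noteq> real (s - 1)) :: real)"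
      by (simp only: of_nat_eq_iff)
  qed
  finally show ?thesis .
qed

text \<open>Relabelling by the inverse of row \<open>i\<close> turns that row into the identity and
  only reorders the sum. The tuple labelled \<open>t\<close> then lies in the slice with
  \<open>i\<close>-th coordinate \<open>t\<close>, the setting of
  \<open>rows_dichotomy\<close>.\<close>

lemma avg_arr_fix_coordinate:
  assumes "finite A" "i \<notin> J"
  shows "avg (arr A (insert i J)) (\<lambda>V. G (\<Sum>t\<in>A. f (sel (insert i J) V t)))
    = avg (arr A J) (\<lambda>V. G (\<Sum>t\<in>A. f ((sel J V t)(i := t))))" (is "_ = ?R")
proof -
  let ?P = "{\<sigma>. \<sigma> permutes A}"
  have ne: "finite ?P" "?P \<noteq> {}"
    using finite_permutations[OF assms(1)] permutes_id by blast+
  have "avg (arr A (insert i J)) (\<lambda>V. G (\<Sum>t\<in>A. f (sel (insert i J) V t)))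
      = avg ?P (\<lambda>\<sigma>. avg (arr A J) (\<lambda>V. G (\<Sum>t\<in>A. f ((sel J V t)(i := \<sigma> t)))))"
    unfolding arr_def avg_PiE_insert[OF assms(2)] sel_insert[OF assms(2)] ..
  also have "\<dots> = avg ?P (\<lambda>\<sigma>. ?R)"
  proof (rule avg_cong)
    fix \<sigma> assume "\<sigma> \<in> ?P"
    then have \<sigma>: "\<sigma> permutes A" by simp
    have "(\<Sum>t\<in>A. f ((v t)(i := \<sigma> t))) = (\<Sum>t\<in>A. f ((v (inv \<sigma> t))(i := t)))" for v
      using sum.reindex_bij_betw[OF permutes_imp_bij[OF \<sigma>], of "\<lambda>t. f ((v (inv \<sigma> t))(i := t))"]
      by (simp add: permutes_inverses[OF \<sigma>])
    then show "avg (arr A J) (\<lambda>V. G (\<Sum>t\<in>A. f ((sel J V t)(i := \<sigma> t)))) = ?R"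
      using avg_arr_relabel[OF permutes_inv[OF \<sigma>], of J "\<lambda>v. G (\<Sum>t\<in>A. f ((v t)(i := t)))"]
      by simp
  qed
  finally show ?thesis using ne by (simp add: avg_const)
qed

section \<open>Splitting the coordinates\<close>

text \<open>
  A one-Lipschitz substitute for \<open>a (1 - a)\<close> with its peak moved to \<open>\<phi>\<close>.
\<close>

definition tent :: "real \<Rightarrow> real \<Rightarrow> real" where
  "tent \<phi> a = min (a * (1 - \<phi>)) ((1 - a) * \<phi>)"

lemma tent_nonneg: "0 \<le> \<phi> \<Longrightarrow> \<phi> \<le> 1 \<Longrightarrow> 0 \<le> a \<Longrightarrow> a \<le> 1 \<Longrightarrow> 0 \<le> tent \<phi> a"
  by (simp add: tent_def)

lemma tent_peak: "tent \<phi> \<phi> = \<phi> * (1 - \<phi>)"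
  by (simp add: tent_def mult.commute)

lemma tent_le_peak:
  assumes "0 \<le> \<phi>" "\<phi> \<le> 1"
  shows "tent \<phi> a \<le> \<phi> * (1 - \<phi>)"
proof (cases "a \<le> \<phi>")
  case True
  then have "a * (1 - \<phi>) \<le> \<phi> * (1 - \<phi>)" using assms by (intro mult_right_mono) auto
  then show ?thesis by (simp add: tent_def)
next
  case False
  then have "(1 - a) * \<phi> \<le> (1 - \<phi>) * \<phi>" using assms by (intro mult_right_mono) auto
  then show ?thesis by (simp add: tent_def mult.commute)
qed

lemma tent_le:
  assumes "0 \<le> \<phi>" "\<phi> \<le> 1"
  shows "0 \<le> a \<Longrightarrow> tent \<phi> a \<le> a" "a \<le> 1 \<Longrightarrow> tent \<phi> a \<le> 1 - a"
  using assms mult_left_le[of "1 - \<phi>" a] mult_left_le[of \<phi> "1 - a"]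
  by (auto simp: tent_def min_le_iff_disj)

lemma tent_lipschitz:
  assumes "0 \<le> \<phi>" "\<phi> \<le> 1"
  shows "\<bar>tent \<phi> a - tent \<phi> b\<bar> \<le> \<bar>a - b\<bar>"
proof -
  have "\<bar>a * (1 - \<phi>) - b * (1 - \<phi>)\<bar> \<le> \<bar>a - b\<bar>"
    using assms mult_left_le[of "1 - \<phi>" "\<bar>a - b\<bar>"]
    by (simp add: left_diff_distrib[symmetric] abs_mult)
  moreover have "\<bar>(1 - a) * \<phi> - (1 - b) * \<phi>\<bar> \<le> \<bar>a - b\<bar>"
    using assms mult_left_le[of \<phi> "\<bar>a - b\<bar>"]
    by (simp add: left_diff_distrib[symmetric] abs_mult abs_minus_commute)
  ultimately show ?thesis unfolding tent_def by linarith
qed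

section \<open>The two modes of the averaged tent function\<close>

lemma avg_square_deviation:
  assumes "finite A" "A \<noteq> {}"
  shows "avg A (\<lambda>t. (b t - avg A b)\<^sup>2) = avg A (\<lambda>t. (b t)\<^sup>2) - (avg A b)\<^sup>2"
proof -
  define e where "e = avg A b"
  have "avg A (\<lambda>t. (b t - e)\<^sup>2) = avg A (\<lambda>t. (b t)\<^sup>2 + (- 2 * e * b t + e\<^sup>2))"
    by (intro avg_cong) (simp add: power2_eq_square algebra_simps)
  also have "\<dots> = avg A (\<lambda>t. (b t)\<^sup>2) + (- 2 * e * avg A b + e\<^sup>2)"
    by (simp only: avg_add avg_cmult avg_const[OF assms])
  finally show ?thesis by (simp add: e_def power2_eq_square)
qed

text \<open>All values lie within \<open>q\<close> of a midpoint, so their second moment about it is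
  at most \<open>q\<^sup>2\<close>; passing to the mean only lowers it, and Cauchy-Schwarz bounds
  the absolute deviations. The triangle inequality alone would give \<open>2 * q\<close>.\<close>

lemma avg_abs_deviation_le:
  fixes a :: "'a \<Rightarrow> real"
  assumes "finite A" "A \<noteq> {}" and q: "0 \<le> q" "\<And>t t'. t \<in> A \<Longrightarrow> t' \<in> A \<Longrightarrow> \<bar>a t - a t'\<bar> \<le> 2 * q"
  shows "avg A (\<lambda>t. \<bar>a t - avg A a\<bar>) \<le> q"
proof -
  define m where "m = avg A a"
  have "Max (a ` A) \<in> a ` A" using assms(1,2) by (intro Max_in) auto
  then obtain t1 where "t1 \<in> A" "Max (a ` A) = a t1" by blast
  then have t1: "t1 \<in> A" "\<And>t. t \<in> A \<Longrightarrow> a t \<le> a t1"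
    using assms(1) Max_ge[of "a ` A"] by auto
  \<comment> \<open>The midpoint of the window of length \<open>2 * q\<close> below the maximum,
    which contains all values.\<close>
  define c where "c = a t1 - q"
  have c: "(a t - c)\<^sup>2 \<le> q\<^sup>2" if "t \<in> A" for t
  proof -
    have "\<bar>a t - c\<bar> \<le> q" using t1(2)[OF that] q(2)[OF that t1(1)] by (auto simp: c_def)
    then show ?thesis using q(1) by (simp add: abs_le_square_iff[symmetric])
  qed
  have "avg A (\<lambda>t. a t - c) = m - c" using assms(1,2) by (simp add: avg_diff avg_const m_def)
  then have "avg A (\<lambda>t. (a t - m)\<^sup>2) = avg A (\<lambda>t. (a t - c)\<^sup>2) - (m - c)\<^sup>2"
    using avg_square_deviation[OF assms(1,2), of "\<lambda>t. a t - c"] by simp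
  also have "\<dots> \<le> avg A (\<lambda>t. (a t - c)\<^sup>2)" by simp
  also have "\<dots> \<le> avg A (\<lambda>_. q\<^sup>2)" using c by (rule avg_mono)
  finally have v: "avg A (\<lambda>t. (a t - m)\<^sup>2) \<le> q\<^sup>2" using assms(1,2) by (simp add: avg_const)
  have "0 \<le> avg A (\<lambda>t. (\<bar>a t - m\<bar> - avg A (\<lambda>t. \<bar>a t - m\<bar>))\<^sup>2)" by (rule avg_nonneg) simp
  also have "\<dots> = avg A (\<lambda>t. (a t - m)\<^sup>2) - (avg A (\<lambda>t. \<bar>a t - m\<bar>))\<^sup>2"
    by (simp add: avg_square_deviation[OF assms(1,2)])
  finally have "(avg A (\<lambda>t. \<bar>a t - m\<bar>))\<^sup>2 \<le> q\<^sup>2" using v by simp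
  then show ?thesis unfolding m_def using q(1) by (rule power2_le_imp_le)
qed

text \<open>\<open>Z\<close> is near 0 when all \<open>a t\<close> are near 0 or 1, and near the
  peak \<open>W\<close> when they cluster near \<open>\<phi>\<close>. The product form records both
  cases at once and is quadratic in \<open>Z\<close>, so it can be averaged and compared with a
  second moment.\<close>

lemma tent_avg_extreme:
  fixes a :: "'a \<Rightarrow> real" and \<phi> q :: real
  assumes A: "finite A" "A \<noteq> {}" and \<phi>: "0 \<le> \<phi>" "\<phi> \<le> 1" and q: "0 \<le> q"
    and a: "\<And>t. t \<in> A \<Longrightarrow> 0 \<le> a t" "\<And>t. t \<in> A \<Longrightarrow> a t \<le> 1"
    and mean: "\<bar>avg A a - \<phi>\<bar> \<le> q"
    and dich: "q < 1 / 8 \<Longrightarrow> (\<forall>t\<in>A. a t \<ge> 1 - 2 * q \<or> a t \<le> 2 * q)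
      \<or> (\<forall>t\<in>A. \<forall>t'\<in>A. \<bar>a t - a t'\<bar> \<le> 2 * q)"
  defines "W \<equiv> \<phi> * (1 - \<phi>)" and "Z \<equiv> avg A (\<lambda>t. tent \<phi> (a t))"
  shows "Z * (W - Z) \<le> 2 * q * W"
proof -
  have Z0: "0 \<le> Z" unfolding Z_def using a \<phi> by (intro avg_nonneg tent_nonneg) auto
  have "Z \<le> avg A (\<lambda>_. W)"
    unfolding Z_def W_def using \<phi> by (intro avg_mono tent_le_peak) auto
  then have ZW: "Z \<le> W" using A by (simp add: avg_const)
  have W4: "W \<le> 1 / 4" unfolding W_def using sum_squares_ge_zero[of "\<phi> - 1/2" 0] by (simp add: algebra_simps power2_eq_square)
  consider (big) "q \<ge> 1 / 8" | (rows) "\<forall>t\<in>A. a t \<ge> 1 - 2 * q \<or> a t \<le> 2 * q"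
    | (flat) "\<forall>t\<in>A. \<forall>t'\<in>A. \<bar>a t - a t'\<bar> \<le> 2 * q"
    using dich by linarith
  then show ?thesis
  proof cases
    \<comment> \<open>No dichotomy is available here, but \<open>W \<le> 1/4 \<le> 2 * q\<close>
      makes the claim trivial.\<close>
    case big
    have "Z * (W - Z) \<le> W * W" using Z0 ZW by (intro mult_mono) auto
    also have "\<dots> \<le> (2 * q) * W" using W4 big Z0 ZW by (intro mult_right_mono) auto
    finally show ?thesis .
  next
    case rows
    have "Z \<le> avg A (\<lambda>_. 2 * q)"
      unfolding Z_def
    proof (rule avg_mono)
      fix t assume t: "t \<in> A"
      show "tent \<phi> (a t) \<le> 2 * q"
        using rows t tent_le(1)[OF \<phi> a(1)[OF t]] tent_le(2)[OF \<phi> a(2)[OF t]] by fastforce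
    qed
    then have "Z \<le> 2 * q" using A by (simp add: avg_const)
    then show ?thesis using Z0 ZW by (intro mult_mono) auto
  next
    case flat
    have "W - Z = (tent \<phi> \<phi> - tent \<phi> (avg A a)) + avg A (\<lambda>t. tent \<phi> (avg A a) - tent \<phi> (a t))"
      using A by (simp add: W_def Z_def tent_peak avg_diff avg_const)
    also have "\<dots> \<le> \<bar>\<phi> - avg A a\<bar> + avg A (\<lambda>t. \<bar>a t - avg A a\<bar>)"
    proof (intro add_mono avg_mono)
      show "tent \<phi> \<phi> - tent \<phi> (avg A a) \<le> \<bar>\<phi> - avg A a\<bar>"
        using tent_lipschitz[OF \<phi>, of \<phi> "avg A a"] by linarith
      show "tent \<phi> (avg A a) - tent \<phi> (a t) \<le> \<bar>a t - avg A a\<bar>" for t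
        using tent_lipschitz[OF \<phi>, of "avg A a" "a t"] by linarith
    qed
    also have "\<dots> \<le> q + q"
      using mean avg_abs_deviation_le[OF A q, of a] flat by (intro add_mono) auto
    finally have "W - Z \<le> 2 * q" by simp
    then have "Z * (W - Z) \<le> W * (2 * q)" using Z0 ZW by (intro mult_mono) auto
    then show ?thesis by (simp add: mult.commute)
  qed
qed

section \<open>Concentration over a random matching of the first block\<close>

lemma sel_join: "sel (S \<union> J) (join S U V) t = join S (sel S U t) (sel J V t)"
  by (auto simp: sel_def join_def restrict_def)

lemma avg_sel_mean:
  assumes "finite S" "finite A" "A \<noteq> {}"
  shows "avg (arr A S) (\<lambda>U. avg A (\<lambda>t. H (sel S U t))) = avg (S \<rightarrow>\<^sub>E A) H"
proof -
  have "avg (arr A S) (\<lambda>U. avg A (\<lambda>t. H (sel S U t))) = avg A (\<lambda>t. avg (S \<rightarrow>\<^sub>E A) H)"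
    by (subst avg_swap) (intro avg_cong avg_sel[OF assms(1,2)])
  then show ?thesis using assms(2,3) by (simp add: avg_const)
qed

text \<open>Expanding the square gives \<open>n\<close> diagonal terms equal to the second moment
  and off-diagonal terms bounded by \<open>avg_sel_pair_le\<close>. The mean of \<open>H\<close>
  over the tuples of a matching thus has variance at most \<open>2 / n\<close> times that of
  \<open>H\<close>.\<close>

lemma avg_sel_mean_square_le:
  fixes H :: "('j \<Rightarrow> 'a) \<Rightarrow> real"
  assumes "finite S" "finite A" "card A \<ge> 2"
  defines "n \<equiv> real (card A)"
  shows "avg (arr A S) (\<lambda>U. (avg A (\<lambda>t. H (sel S U t)))\<^sup>2)
    \<le> 2 / n * avg (S \<rightarrow>\<^sub>E A) (\<lambda>x. (H x)\<^sup>2) + (1 - 2 / n) * (avg (S \<rightarrow>\<^sub>E A) H)\<^sup>2"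
proof -
  define m where "m = avg (S \<rightarrow>\<^sub>E A) H"
  define v where "v = avg (S \<rightarrow>\<^sub>E A) (\<lambda>x. (H x)\<^sup>2)"
  define c where "c = (1 - 1 / (n - 1)) * m\<^sup>2 + 1 / (n - 1) * v"
  have n: "n \<ge> 2" using assms(3) by (simp add: n_def)
  let ?e = "\<lambda>t t'. avg (arr A S) (\<lambda>U. H (sel S U t) * H (sel S U t'))"
  have diag: "?e t t = v" if "t \<in> A" for t
    using avg_sel[OF assms(1,2) that, of "\<lambda>x. (H x)\<^sup>2"] by (simp add: v_def power2_eq_square)
  have off: "?e t t' \<le> c" if "t \<in> A" "t' \<in> A - {t}" for t t'
    using avg_sel_pair_le[OF assms(1,2,3), of t t' H] that by (auto simp: c_def m_def v_def n_def)
  have "avg (arr A S) (\<lambda>U. (avg A (\<lambda>t. H (sel S U t)))\<^sup>2)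
      = avg (arr A S) (\<lambda>U. (1 / n\<^sup>2) * (\<Sum>t\<in>A. \<Sum>t'\<in>A. H (sel S U t) * H (sel S U t')))"
    by (simp add: avg_def n_def power2_eq_square sum_product)
  also have "\<dots> = (1 / n\<^sup>2) * (\<Sum>t\<in>A. \<Sum>t'\<in>A. ?e t t')"
    by (simp only: avg_cmult avg_sum)
  also have "\<dots> \<le> 1 / n\<^sup>2 * (\<Sum>t\<in>A. v + (n - 1) * c)"
  proof (intro mult_left_mono sum_mono)
    fix t assume t: "t \<in> A"
    have "(\<Sum>t'\<in>A. ?e t t') = v + (\<Sum>t'\<in>A - {t}. ?e t t')"
      using t assms(2) diag by (simp add: sum.remove[of A t])
    also have "(\<Sum>t'\<in>A - {t}. ?e t t') \<le> (\<Sum>t'\<in>A - {t}. c)"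
      using off t by (intro sum_mono) auto
    also have "\<dots> = (n - 1) * c" using t assms(2,3) by (simp add: n_def of_nat_diff)
    finally show "(\<Sum>t'\<in>A. ?e t t') \<le> v + (n - 1) * c" by simp
  qed simp
  also have "(\<Sum>t\<in>A. v + (n - 1) * c) = n * (v + (n - 1) * c)" by (simp add: n_def)
  also have "1 / n\<^sup>2 * (n * (v + (n - 1) * c)) = 1 / n * (v + (n - 1) * c)"
    using n by (simp add: power2_eq_square)
  also have "(n - 1) * c = (n - 2) * m\<^sup>2 + v"
  proof -
    have "d * ((1 - 1 / d) * m\<^sup>2 + 1 / d * v) = (d - 1) * m\<^sup>2 + v" if "d \<noteq> 0" for d
      using that by (simp add: field_simps)
    from this[of "n - 1"] n show ?thesis by (simp add: c_def)
  qed
  also have "1 / n * (v + ((n - 2) * m\<^sup>2 + v)) = 2 / n * v + (1 - 2 / n) * m\<^sup>2"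
    using n by (simp add: field_simps)
  finally show ?thesis by (simp add: m_def v_def)
qed

text \<open>Condition on the part \<open>U\<close> of the matching over \<open>S\<close>. The
  sections over its points satisfy \<open>rows_dichotomy\<close> with conditional failure
  probability \<open>q U\<close>, so by \<open>tent_avg_extreme\<close> the mean \<open>Z U\<close>
  lies near 0 or near \<open>W\<close>. As \<open>Z U\<close> concentrates about its expectation
  \<open>E\<close>, also \<open>E\<close> must lie near one end.\<close>

lemma split_balance_le:
  fixes f :: "('j \<Rightarrow> 'a) \<Rightarrow> real" and r :: real
  assumes fin: "finite S" "finite J" "S \<inter> J = {}" and A: "finite A" "card A \<ge> 4"
    and f: "\<And>x. f x \<in> {0, 1}" and r: "0 \<le> r" "r \<le> real (card A)"
  defines "n \<equiv> real (card A)"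
  defines "p \<equiv> avg (arr A (S \<union> J)) (\<lambda>V. of_bool ((\<Sum>t\<in>A. f (sel (S \<union> J) V t)) \<noteq> r))"
  defines "W \<equiv> r / n * (1 - r / n)"
  defines "E \<equiv> avg (S \<rightarrow>\<^sub>E A) (\<lambda>u. tent (r / n) (avg (J \<rightarrow>\<^sub>E A) (\<lambda>v. f (join S u v))))"
  shows "(1 - 2 / n) * (E * (W - E)) \<le> 2 * p * W"
proof -
  define \<phi> where "\<phi> = r / n"
  have n: "n \<ge> 4" "A \<noteq> {}" using A by (auto simp: n_def)
  have \<phi>: "0 \<le> \<phi>" "\<phi> \<le> 1" using r n by (auto simp: \<phi>_def n_def)
  define a where "a u = avg (J \<rightarrow>\<^sub>E A) (\<lambda>v. f (join S u v))" for u
  define H where "H u = tent \<phi> (a u)" for u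
  define q where "q U = avg (arr A J) (\<lambda>V. of_bool ((\<Sum>t\<in>A. f (join S (sel S U t) (sel J V t))) \<noteq> r))" for U
  define Z where "Z U = avg A (\<lambda>t. H (sel S U t))" for U
  have X: "finite (J \<rightarrow>\<^sub>E A)" "J \<rightarrow>\<^sub>E A \<noteq> {}" "finite (S \<rightarrow>\<^sub>E A)" "S \<rightarrow>\<^sub>E A \<noteq> {}"
    using fin A n(2) by (auto simp: finite_PiE PiE_eq_empty_iff)
  have a01: "0 \<le> a u" "a u \<le> 1" for u
  proof -
    have f01: "0 \<le> f x" "f x \<le> 1" for x using f[of x] by auto
    show "0 \<le> a u" unfolding a_def by (intro avg_nonneg f01)
    have "a u \<le> avg (J \<rightarrow>\<^sub>E A) (\<lambda>_. 1)" unfolding a_def by (intro avg_mono f01)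
    then show "a u \<le> 1" using X by (simp add: avg_const)
  qed
  have p: "p = avg (arr A S) q"
    unfolding p_def arr_def avg_PiE_Un[OF fin(1,3)] sel_join q_def ..
  have Zq: "Z U * (W - Z U) \<le> 2 * q U * W" if U: "U \<in> arr A S" for U
  proof -
    let ?F = "\<lambda>t v. f (join S (sel S U t) v)"
    have aF: "a (sel S U t) = avg (J \<rightarrow>\<^sub>E A) (?F t)" for t by (simp add: a_def)
    have q0: "0 \<le> q U" unfolding q_def by (rule avg_nonneg) simp
    \<comment> \<open>The sum over the labels equals \<open>r\<close> outside an event of
      probability \<open>q U\<close>, and is off by at most \<open>n\<close> on it.\<close>
    have "\<bar>avg A (\<lambda>t. a (sel S U t)) - \<phi>\<bar> \<le> q U"
    proof -
      have "avg A (\<lambda>t. a (sel S U t)) = avg A (\<lambda>t. avg (arr A J) (\<lambda>V. ?F t (sel J V t)))"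
        unfolding aF by (intro avg_cong avg_sel[OF fin(2) A(1), symmetric])
      also have "\<dots> = avg (arr A J) (\<lambda>V. avg A (\<lambda>t. ?F t (sel J V t)))" by (rule avg_swap)
      finally have "avg A (\<lambda>t. a (sel S U t)) - \<phi>
          = avg (arr A J) (\<lambda>V. avg A (\<lambda>t. ?F t (sel J V t)) - \<phi>)"
        using finite_arr[OF A(1) fin(2)] arr_nonempty[of A J] by (simp add: avg_diff avg_const)
      also have "\<bar>\<dots>\<bar> \<le> avg (arr A J) (\<lambda>V. \<bar>avg A (\<lambda>t. ?F t (sel J V t)) - \<phi>\<bar>)"
        by (rule avg_abs)
      also have "\<dots> \<le> q U" unfolding q_def
      proof (rule avg_mono)
        fix V
        let ?s = "\<Sum>t\<in>A. ?F t (sel J V t)"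
        have f01: "0 \<le> f x" "f x \<le> 1" for x using f[of x] by auto
        have s: "0 \<le> ?s" "?s \<le> n"
          using sum_mono[of A "\<lambda>t. ?F t (sel J V t)" "\<lambda>_. 1"] f01 by (auto simp: n_def intro: sum_nonneg)
        have "avg A (\<lambda>t. ?F t (sel J V t)) - \<phi> = (?s - r) / n"
          by (simp add: avg_def \<phi>_def n_def diff_divide_distrib)
        moreover have "\<bar>(?s - r) / n\<bar> \<le> of_bool (?s \<noteq> r)"
        proof (cases "?s = r")
          case False
          have "\<bar>?s - r\<bar> \<le> n" using s r by (auto simp: n_def)
          with False n(1) show ?thesis by (simp add: abs_divide)
        qed simp
        ultimately show "\<bar>avg A (\<lambda>t. ?F t (sel J V t)) - \<phi>\<bar> \<le> of_bool (?s \<noteq> r)"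
          by simp
      qed
      finally show ?thesis .
    qed
    moreover have "(\<forall>t\<in>A. a (sel S U t) \<ge> 1 - 2 * q U \<or> a (sel S U t) \<le> 2 * q U)
        \<or> (\<forall>t\<in>A. \<forall>t'\<in>A. \<bar>a (sel S U t) - a (sel S U t')\<bar> \<le> 2 * q U)" if "q U < 1 / 8"
    proof -
      have "\<bar>a (sel S U t) - a (sel S U t')\<bar> \<le> avg (J \<rightarrow>\<^sub>E A) (\<lambda>v. \<bar>?F t v - ?F t' v\<bar>)" for t t'
        using avg_abs[of "J \<rightarrow>\<^sub>E A" "\<lambda>v. ?F t v - ?F t' v"] by (simp add: aF avg_diff)
      then show ?thesis
        using rows_dichotomy[OF fin(2) A f, of "\<lambda>t. join S (sel S U t)" r "q U"] that
        unfolding aF q_def by (meson order_refl order_trans)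
    qed
    ultimately show ?thesis
      using tent_avg_extreme[OF A(1) n(2) \<phi> q0, of "\<lambda>t. a (sel S U t)"] a01
      by (simp add: Z_def H_def W_def \<phi>_def)
  qed
  have E: "E = avg (S \<rightarrow>\<^sub>E A) H"
    unfolding E_def by (intro avg_cong) (simp add: H_def a_def \<phi>_def)
  have EZ: "avg (arr A S) Z = E"
    unfolding Z_def E by (rule avg_sel_mean[OF fin(1) A(1) n(2)])
  have H: "0 \<le> H u" "H u \<le> W" for u
    using tent_nonneg[OF \<phi> a01] tent_le_peak[OF \<phi>] by (auto simp: H_def W_def \<phi>_def)
  \<comment> \<open>Since \<open>0 \<le> H \<le> W\<close>, the second moment is at most
    \<open>W * E\<close>, which makes the variance bound a multiple of
    \<open>E * (W - E)\<close>.\<close>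
  have "avg (S \<rightarrow>\<^sub>E A) (\<lambda>x. (H x)\<^sup>2) \<le> avg (S \<rightarrow>\<^sub>E A) (\<lambda>x. W * H x)"
    unfolding power2_eq_square by (intro avg_mono mult_right_mono H)
  then have H2: "avg (S \<rightarrow>\<^sub>E A) (\<lambda>x. (H x)\<^sup>2) \<le> W * E" by (simp add: avg_cmult E)
  have Z2: "avg (arr A S) (\<lambda>U. (Z U)\<^sup>2) \<le> 2 / n * (W * E) + (1 - 2 / n) * E\<^sup>2"
  proof -
    have "avg (arr A S) (\<lambda>U. (Z U)\<^sup>2)
        \<le> 2 / n * avg (S \<rightarrow>\<^sub>E A) (\<lambda>x. (H x)\<^sup>2) + (1 - 2 / n) * E\<^sup>2"
      using avg_sel_mean_square_le[OF fin(1) A(1), of H] A(2) by (simp add: Z_def E n_def)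
    also have "\<dots> \<le> 2 / n * (W * E) + (1 - 2 / n) * E\<^sup>2"
      using H2 n(1) by (intro add_right_mono mult_left_mono) auto
    finally show ?thesis .
  qed
  have "(1 - 2 / n) * (E * (W - E)) = W * E - (2 / n * (W * E) + (1 - 2 / n) * E\<^sup>2)"
    by (simp add: algebra_simps power2_eq_square)
  also have "\<dots> \<le> W * E - avg (arr A S) (\<lambda>U. (Z U)\<^sup>2)" using Z2 by simp
  also have "\<dots> = avg (arr A S) (\<lambda>U. Z U * (W - Z U))"
    by (simp add: EZ[symmetric] avg_cmult[symmetric] avg_diff[symmetric] algebra_simps power2_eq_square)
  also have "\<dots> \<le> avg (arr A S) (\<lambda>U. 2 * q U * W)" by (rule avg_mono) (rule Zq)
  also have "\<dots> = 2 * p * W" by (simp add: p avg_cmult avg_multc)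
  finally show ?thesis .
qed

text \<open>Moving \<open>i\<close> into the first block replaces the section density
  \<open>avg A (g u)\<close> by its refinements \<open>g u a\<close>. The tent function is
  1-Lipschitz, so the change is at most the mean difference between parallel slices in direction
  \<open>i\<close>.\<close>

lemma tent_split_step:
  fixes f :: "('j \<Rightarrow> 'a) \<Rightarrow> real"
  assumes fin: "finite S" "finite J" "S \<inter> J = {}" "i \<notin> S" "i \<notin> J"
    and A: "finite A" "A \<noteq> {}" and \<phi>: "0 \<le> \<phi>" "\<phi> \<le> 1"
    and \<delta>: "\<And>a b. a \<in> A \<Longrightarrow> b \<in> A \<Longrightarrow>
      avg (S \<union> J \<rightarrow>\<^sub>E A) (\<lambda>w. \<bar>f (w(i := a)) - f (w(i := b))\<bar>) \<le> \<delta>"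
  shows "\<bar>avg (insert i S \<rightarrow>\<^sub>E A) (\<lambda>u. tent \<phi> (avg (J \<rightarrow>\<^sub>E A) (\<lambda>v. f (join (insert i S) u v))))
    - avg (S \<rightarrow>\<^sub>E A) (\<lambda>u. tent \<phi> (avg (insert i J \<rightarrow>\<^sub>E A) (\<lambda>v. f (join S u v))))\<bar> \<le> \<delta>"
    (is "\<bar>?L - ?R\<bar> \<le> \<delta>")
proof -
  define g where "g u b = avg (J \<rightarrow>\<^sub>E A) (\<lambda>v. f ((join S u v)(i := b)))" for u b
  have j1: "join (insert i S) (u(i := a)) v = (join S u v)(i := a)" for u v and a :: 'a
    using fin(4) by (auto simp: join_def)
  have j2: "join S u (v(i := b)) = (join S u v)(i := b)" for u v and b :: 'a
    using fin(4) by (auto simp: join_def)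
  have L: "?L = avg A (\<lambda>a. avg (S \<rightarrow>\<^sub>E A) (\<lambda>u. tent \<phi> (g u a)))"
    unfolding avg_PiE_insert[OF fin(4)] j1 g_def ..
  \<comment> \<open>The average over \<open>a\<close> is a dummy one, added so that both sides can
    be compared term by term.\<close>
  have R: "?R = avg A (\<lambda>a. avg (S \<rightarrow>\<^sub>E A) (\<lambda>u. tent \<phi> (avg A (g u))))"
    unfolding avg_PiE_insert[OF fin(5)] j2 g_def[symmetric] avg_const[OF A] ..
  have "\<bar>?L - ?R\<bar> \<le> avg A (\<lambda>a. avg (S \<rightarrow>\<^sub>E A) (\<lambda>u. \<bar>tent \<phi> (g u a) - tent \<phi> (avg A (g u))\<bar>))"
  proof -
    have "\<bar>?L - ?R\<bar> = \<bar>avg A (\<lambda>a. avg (S \<rightarrow>\<^sub>E A) (\<lambda>u. tent \<phi> (g u a) - tent \<phi> (avg A (g u))))\<bar>"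
      by (simp only: L R avg_diff)
    also have "\<dots> \<le> avg A (\<lambda>a. \<bar>avg (S \<rightarrow>\<^sub>E A) (\<lambda>u. tent \<phi> (g u a) - tent \<phi> (avg A (g u)))\<bar>)"
      by (rule avg_abs)
    also have "\<dots> \<le> avg A (\<lambda>a. avg (S \<rightarrow>\<^sub>E A) (\<lambda>u. \<bar>tent \<phi> (g u a) - tent \<phi> (avg A (g u))\<bar>))"
      by (intro avg_mono avg_abs)
    finally show ?thesis .
  qed
  also have "\<dots> \<le> avg A (\<lambda>a. avg (S \<rightarrow>\<^sub>E A) (\<lambda>u. avg A (\<lambda>b. avg (J \<rightarrow>\<^sub>E A)
      (\<lambda>v. \<bar>f ((join S u v)(i := a)) - f ((join S u v)(i := b))\<bar>))))"
  proof (intro avg_mono)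
    fix a u
    have "\<bar>tent \<phi> (g u a) - tent \<phi> (avg A (g u))\<bar> \<le> \<bar>g u a - avg A (g u)\<bar>"
      by (rule tent_lipschitz[OF \<phi>])
    also have "g u a - avg A (g u) = avg A (\<lambda>b. g u a - g u b)"
      by (simp only: avg_diff avg_const[OF A])
    also have "\<bar>\<dots>\<bar> \<le> avg A (\<lambda>b. \<bar>g u a - g u b\<bar>)" by (rule avg_abs)
    also have "\<dots> \<le> avg A (\<lambda>b. avg (J \<rightarrow>\<^sub>E A)
        (\<lambda>v. \<bar>f ((join S u v)(i := a)) - f ((join S u v)(i := b))\<bar>))"
    proof (rule avg_mono)
      fix b
      show "\<bar>g u a - g u b\<bar> \<le> avg (J \<rightarrow>\<^sub>E A)
          (\<lambda>v. \<bar>f ((join S u v)(i := a)) - f ((join S u v)(i := b))\<bar>)"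
        using avg_abs[of "J \<rightarrow>\<^sub>E A" "\<lambda>v. f ((join S u v)(i := a)) - f ((join S u v)(i := b))"]
        by (simp only: g_def avg_diff)
    qed
    finally show "\<bar>tent \<phi> (g u a) - tent \<phi> (avg A (g u))\<bar> \<le> avg A (\<lambda>b. avg (J \<rightarrow>\<^sub>E A)
        (\<lambda>v. \<bar>f ((join S u v)(i := a)) - f ((join S u v)(i := b))\<bar>))" .
  qed
  also have "\<dots> = avg A (\<lambda>a. avg A (\<lambda>b. avg (S \<union> J \<rightarrow>\<^sub>E A) (\<lambda>w. \<bar>f (w(i := a)) - f (w(i := b))\<bar>)))"
    unfolding avg_PiE_Un[OF fin(1,3)] by (intro avg_cong avg_swap)
  also have "\<dots> \<le> avg A (\<lambda>a. avg A (\<lambda>b. \<delta>))"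
    by (intro avg_mono \<delta>)
  finally show ?thesis by (simp only: avg_const[OF A])
qed

section \<open>Fat and thin hyperplanes\<close>

locale matching_family =
  fixes n k s :: nat and \<F> :: "(nat \<Rightarrow> nat) set"
  assumes n1: "n \<ge> 1" and k1: "k \<ge> 1" and s1: "s \<ge> 1"
    and F_subset: "\<F> \<subseteq> tuples n k"
    and card_F: "card \<F> = (s - 1) * n ^ (k - 1) + 1"
begin

abbreviation p :: real where "p \<equiv> p_fail n k s \<F>"

definition f :: "(nat \<Rightarrow> nat) \<Rightarrow> real" where "f x = of_bool (x \<in> \<F>)"

definition dens :: "nat \<Rightarrow> nat \<Rightarrow> real" where
  "dens i a = avg ({1..k} - {i} \<rightarrow>\<^sub>E {1..n}) (\<lambda>v. f (v(i := a)))"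

lemma A_ne: "finite {1..n}" "{1..n} \<noteq> {}" using n1 by auto

lemma f01: "f x \<in> {0, 1}" by (simp add: f_def)

lemma cube_ne: "finite (J \<rightarrow>\<^sub>E {1..n})" "J \<rightarrow>\<^sub>E {1..n} \<noteq> {}" if "finite J"
  using that A_ne by (auto simp: finite_PiE PiE_eq_empty_iff)

lemma p_nonneg: "0 \<le> p" by (simp add: p_fail_def)

lemma card_hyperplane:
  assumes "i \<in> {1..k}" "a \<in> {1..n}"
  shows "real (card (hyperplane n k i a \<inter> \<F>)) = dens i a * real n ^ (k - 1)"
proof -
  let ?X = "{1..k} - {i} \<rightarrow>\<^sub>E {1..n}"
  let ?S = "{v \<in> ?X. v(i := a) \<in> \<F>}"
  have K: "insert i ({1..k} - {i}) = {1..k}" using assms(1) by auto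
  have "bij_betw (\<lambda>v. v(i := a)) ?S (hyperplane n k i a \<inter> \<F>)"
  proof (rule bij_betw_byWitness[where f' = "\<lambda>x. x(i := undefined)"])
    show "\<forall>v\<in>?S. (v(i := a))(i := undefined) = v"
    proof
      fix v assume "v \<in> ?S"
      then have "v i = undefined" by (intro PiE_arb[of v "{1..k} - {i}" "\<lambda>_. {1..n}"]) auto
      then show "(v(i := a))(i := undefined) = v" by auto
    qed
    show "\<forall>x\<in>hyperplane n k i a \<inter> \<F>. (x(i := undefined))(i := a) = x"
      by (auto simp: hyperplane_def)
    show "(\<lambda>v. v(i := a)) ` ?S \<subseteq> hyperplane n k i a \<inter> \<F>"
    proof (rule image_subsetI)
      fix v assume "v \<in> ?S"
      then have "v(i := a) \<in> \<F>" by simp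
      with F_subset show "v(i := a) \<in> hyperplane n k i a \<inter> \<F>"
        by (auto simp: hyperplane_def simp del: fun_upd_apply) simp
    qed
    show "(\<lambda>x. x(i := undefined)) ` (hyperplane n k i a \<inter> \<F>) \<subseteq> ?S"
    proof (rule image_subsetI)
      fix x assume x: "x \<in> hyperplane n k i a \<inter> \<F>"
      then have "x \<in> insert i ({1..k} - {i}) \<rightarrow>\<^sub>E {1..n}" "x i = a"
        unfolding K by (auto simp: hyperplane_def tuples_def)
      then have "x(i := undefined) \<in> ?X" by (intro fun_upd_in_PiE) auto
      moreover have "(x(i := undefined))(i := a) = x" using \<open>x i = a\<close> by auto
      ultimately show "x(i := undefined) \<in> ?S" using x by simp
    qed
  qed
  then have "card (hyperplane n k i a \<inter> \<F>) = card ?S" by (simp add: bij_betw_same_card)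
  moreover have "card ?X = n ^ (k - 1)" using assms(1) by (simp add: card_PiE)
  moreover have "(\<Sum>v\<in>?X. f (v(i := a))) = real (card ?S)"
    using cube_ne(1)[of "{1..k} - {i}"] by (simp add: f_def of_bool_def sum.If_cases Int_def)
  ultimately show ?thesis using n1 by (simp add: dens_def avg_def)
qed

lemma fat_iff:
  assumes "i \<in> {1..k}" "a \<in> {1..n}"
  shows "fat n k s \<F> (hyperplane n k i a) \<longleftrightarrow> dens i a \<ge> 1 - 2 * p"
  using n1 by (simp add: fat_def card_hyperplane[OF assms])

lemma thin_iff:
  assumes "i \<in> {1..k}" "a \<in> {1..n}"
  shows "thin n k s \<F> (hyperplane n k i a) \<longleftrightarrow> dens i a \<le> 2 * p"
  using n1 by (simp add: thin_def card_hyperplane[OF assms])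

lemma avg_f: "avg ({1..k} \<rightarrow>\<^sub>E {1..n}) f = real (s - 1) / real n + 1 / real n ^ k"
proof -
  let ?X = "{1..k} \<rightarrow>\<^sub>E {1..n}"
  have "(\<Sum>x\<in>?X. f x) = real (card (?X \<inter> \<F>))"
    using cube_ne(1)[of "{1..k}"] by (simp add: f_def of_bool_def sum.If_cases Int_def)
  also have "?X \<inter> \<F> = \<F>" using F_subset by (auto simp: tuples_def)
  finally have "avg ?X f = real ((s - 1) * n ^ (k - 1) + 1) / real (n ^ k)"
    by (simp add: avg_def card_PiE card_F)
  moreover have "real n ^ k = real n * real n ^ (k - 1)" using k1 by (simp add: power_eq_if)
  moreover have "(R * N + 1) / (m * N) = R / m + 1 / (m * N)" if "N \<noteq> 0" for R N m :: real
    using that by (simp add: add_divide_distrib)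
  ultimately show ?thesis using n1 by (simp add: add.commute)
qed

lemma sum_dens:
  assumes "i \<in> {1..k}"
  shows "(\<Sum>a\<in>{1..n}. dens i a) = real (s - 1) + 1 / real n ^ (k - 1)"
proof -
  have K: "insert i ({1..k} - {i}) = {1..k}" using assms by auto
  have "avg ({1..k} \<rightarrow>\<^sub>E {1..n}) f = avg {1..n} (dens i)"
    using avg_PiE_insert[of i "{1..k} - {i}" "{1..n}" f] unfolding K by (simp add: dens_def[abs_def])
  then have "(\<Sum>a\<in>{1..n}. dens i a) = real n * (real (s - 1) / real n + 1 / real n ^ k)"
    unfolding avg_f using n1 by (simp add: avg_def field_simps)
  moreover have "real n ^ k = real n * real n ^ (k - 1)" using k1 by (simp add: power_eq_if)
  ultimately show ?thesis using n1 by (simp add: distrib_left)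
qed

lemma p_eq: "p = avg (arr {1..n} {1..k}) (\<lambda>V. of_bool ((\<Sum>t\<in>{1..n}. f (sel {1..k} V t)) \<noteq> real (s - 1)))"
  unfolding f_def by (rule p_fail_eq_avg[OF k1])

lemma dens_dichotomy:
  assumes "n \<ge> 4" "p < 1 / 8" "i \<in> {1..k}"
  shows "(\<forall>a\<in>{1..n}. dens i a \<ge> 1 - 2 * p \<or> dens i a \<le> 2 * p)
    \<or> (\<forall>a\<in>{1..n}. \<forall>b\<in>{1..n}.
        avg ({1..k} - {i} \<rightarrow>\<^sub>E {1..n}) (\<lambda>v. \<bar>f (v(i := a)) - f (v(i := b))\<bar>) \<le> 2 * p)"
proof -
  have K: "insert i ({1..k} - {i}) = {1..k}" using assms(3) by auto
  have "avg (arr {1..n} ({1..k} - {i}))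
      (\<lambda>V. of_bool ((\<Sum>t\<in>{1..n}. f ((sel ({1..k} - {i}) V t)(i := t))) \<noteq> real (s - 1))) = p"
    using avg_arr_fix_coordinate[of "{1..n}" i "{1..k} - {i}" "\<lambda>x. of_bool (x \<noteq> real (s - 1))" f]
    unfolding K p_eq by simp
  then show ?thesis
    using rows_dichotomy[of "{1..k} - {i}" "{1..n}" "\<lambda>t v. f (v(i := t))" "real (s - 1)" p] assms(1,2) f01
    by (simp only: dens_def finite_atLeastAtMost finite_Diff card_atLeastAtMost diff_Suc_1 order_refl
        Suc_eq_plus1[symmetric])
qed

text \<open>For \<open>k = 1\<close> the whole cube is the only perfect matching, and it contains
  all \<open>s\<close> members of the family. This excludes \<open>k = 1\<close> wherever
  \<open>p\<close> is small, and so justifies the exponent \<open>k - 2\<close>.\<close>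

lemma p_fail_k1:
  assumes "k = 1"
  shows "p = 1"
proof -
  have c: "card (tuples n k) = n" "finite (tuples n k)"
    using assms by (simp_all add: tuples_def card_PiE finite_PiE)
  have "xi \<F> M = s" if "perfect_matching n k M" for M
  proof -
    have "M = tuples n k"
      using that c by (intro card_subset_eq) (auto simp: perfect_matching_def)
    then have "\<F> \<inter> M = \<F>" using F_subset by auto
    then show ?thesis using card_F assms s1 by (simp add: xi_def)
  qed
  then have "{M. perfect_matching n k M} \<inter> {M. xi \<F> M \<noteq> s - 1} = {M. perfect_matching n k M}"
    using s1 by auto
  then show ?thesis
    using perfect_matchings_nonempty[OF k1, of n] finite_perfect_matchings[of n k]
    by (simp add: p_fail_def random_matching_def measure_pmf_of_set)
qed

text \<open>When all slices are close to each other, the bound comes from comparison with a slice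
  that holds at most \<open>(s - 1) * n ^ (k - 2)\<close> members of the family.\<close>

lemma dichotomy_fat_thin:
  assumes "n \<ge> 4" "p < 1 / 8" "i \<in> {1..k}"
  shows "(\<forall>a\<in>{1..n}. real (card (hyperplane n k i a \<inter> \<F>))
        \<le> 2 * p * real n ^ (k - 1) + (real s - 1) * real n powi (int k - 2))
    \<or> (\<exists>F T. {1..n} = F \<union> T \<and> F \<inter> T = {}
        \<and> (\<forall>a\<in>F. fat n k s \<F> (hyperplane n k i a))
        \<and> (\<forall>a\<in>T. thin n k s \<F> (hyperplane n k i a)))"
  using dens_dichotomy[OF assms]
proof
  assume *: "\<forall>a\<in>{1..n}. dens i a \<ge> 1 - 2 * p \<or> dens i a \<le> 2 * p"
  let ?F = "{a \<in> {1..n}. dens i a \<ge> 1 - 2 * p}"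
  have "{1..n} = ?F \<union> ({1..n} - ?F)" "?F \<inter> ({1..n} - ?F) = {}" by auto
  moreover have "\<forall>a\<in>?F. fat n k s \<F> (hyperplane n k i a)"
    using fat_iff[OF assms(3)] by simp
  moreover have "\<forall>a\<in>{1..n} - ?F. thin n k s \<F> (hyperplane n k i a)"
  proof
    fix a assume a: "a \<in> {1..n} - ?F"
    then have "dens i a \<le> 2 * p" using * by blast
    with a thin_iff[OF assms(3)] show "thin n k s \<F> (hyperplane n k i a)" by blast
  qed
  ultimately show ?thesis by blast
next
  assume *: "\<forall>a\<in>{1..n}. \<forall>b\<in>{1..n}.
      avg ({1..k} - {i} \<rightarrow>\<^sub>E {1..n}) (\<lambda>v. \<bar>f (v(i := a)) - f (v(i := b))\<bar>) \<le> 2 * p"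
  have "k \<noteq> 1" using p_fail_k1 assms(2) by auto
  then have k2: "k \<ge> 2" using k1 by simp
  let ?N = "real n ^ (k - 1)"
  have N: "?N = real n * real n ^ (k - 2)" "?N > 0"
  proof -
    have "k - 1 = Suc (k - 2)" using k2 by simp
    then show "?N = real n * real n ^ (k - 2)" by (simp only: power_Suc)
    show "?N > 0" using n1 by simp
  qed
  have pow: "real n powi (int k - 2) = real n ^ (k - 2)"
  proof -
    have "int k - 2 = int (k - 2)" using k2 by simp
    then show ?thesis by (metis power_int_of_nat)
  qed
  \<comment> \<open>If every slice held at least one member more than this, the family would have at
    least \<open>(s - 1) * n ^ (k - 1) + n\<close> members, exceeding its surplus of one.\<close>
  have "\<exists>b\<in>{1..n}. card (hyperplane n k i b \<inter> \<F>) \<le> (s - 1) * n ^ (k - 2)"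
  proof (rule ccontr)
    assume "\<not> ?thesis"
    then have none: "\<forall>b\<in>{1..n}. \<not> card (hyperplane n k i b \<inter> \<F>) \<le> (s - 1) * n ^ (k - 2)"
      by blast
    have "real ((s - 1) * n ^ (k - 2) + 1) \<le> dens i b * ?N" if b: "b \<in> {1..n}" for b
    proof -
      have "(s - 1) * n ^ (k - 2) + 1 \<le> card (hyperplane n k i b \<inter> \<F>)"
        using bspec[OF none b] by (simp only: not_le Suc_eq_plus1[symmetric] Suc_le_eq)
      then show ?thesis unfolding card_hyperplane[OF assms(3) b, symmetric] by (rule of_nat_mono)
    qed
    then have "(\<Sum>b\<in>{1..n}. dens i b * ?N) \<ge> (\<Sum>b\<in>{1..n}. real ((s - 1) * n ^ (k - 2) + 1))"
      by (intro sum_mono) auto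
    then have "(real (s - 1) + 1 / ?N) * ?N \<ge> real n * (real (s - 1) * real n ^ (k - 2) + 1)"
      by (simp only: sum_distrib_right[symmetric] sum_dens[OF assms(3)]) (simp add: add.commute)
    moreover have "(real (s - 1) + 1 / ?N) * ?N = real (s - 1) * ?N + 1"
      using n1 by (simp add: distrib_right)
    moreover have "real (s - 1) * ?N = real n * (real (s - 1) * real n ^ (k - 2))"
      unfolding N(1) by (simp only: mult_ac)
    ultimately show False using assms(1) by (simp only: distrib_left)
  qed
  then obtain b where b: "b \<in> {1..n}" "card (hyperplane n k i b \<inter> \<F>) \<le> (s - 1) * n ^ (k - 2)"
    by blast
  have "real (card (hyperplane n k i a \<inter> \<F>)) \<le> 2 * p * ?N + (real s - 1) * real n powi (int k - 2)"
    if a: "a \<in> {1..n}" for a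
  proof -
    have "dens i a - dens i b \<le> avg ({1..k} - {i} \<rightarrow>\<^sub>E {1..n}) (\<lambda>v. \<bar>f (v(i := a)) - f (v(i := b))\<bar>)"
      using avg_mono[of "{1..k} - {i} \<rightarrow>\<^sub>E {1..n}" "\<lambda>v. f (v(i := a)) - f (v(i := b))"
          "\<lambda>v. \<bar>f (v(i := a)) - f (v(i := b))\<bar>"] by (simp add: dens_def avg_diff)
    also have "\<dots> \<le> 2 * p" using * a b(1) by blast
    finally have "dens i a * ?N \<le> (2 * p + dens i b) * ?N"
      using N(2) by (intro mult_right_mono) auto
    also have "\<dots> = 2 * p * ?N + real (card (hyperplane n k i b \<inter> \<F>))"
      using card_hyperplane[OF assms(3) b(1)] by (simp add: algebra_simps)
    also have "\<dots> \<le> 2 * p * ?N + real ((s - 1) * n ^ (k - 2))"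
      using b(2) by (intro add_left_mono of_nat_mono)
    finally show ?thesis
      using card_hyperplane[OF assms(3) a] s1 by (simp add: pow of_nat_diff)
  qed
  then show ?thesis by blast
qed

end

section \<open>Number and direction of the fat slices\<close>

locale small_failure = matching_family +
  assumes n8: "n \<ge> 8" and s3: "s \<ge> 3" and p_le: "p \<le> 1 / (4 * real n * (real s - 1))"
begin

definition r :: real where "r = real (s - 1)"

lemma r_eq: "r = real s - 1" using s3 by (simp add: r_def of_nat_diff)

lemma k2: "k \<ge> 2"
proof (rule ccontr)
  assume "\<not> k \<ge> 2"
  then have "p = 1" using k1 p_fail_k1 by simp
  moreover have "4 * real n * (real s - 1) \<ge> 4 * 8 * 2"
    using n8 s3 by (intro mult_mono) auto
  ultimately show False using p_le by (simp add: field_simps)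
qed

lemma r_bounds: "2 \<le> r" "r \<le> real n - 1"
proof -
  show "2 \<le> r" using s3 by (simp add: r_eq)
  have "card \<F> \<le> card (tuples n k)"
    using F_subset by (intro card_mono) (auto simp: tuples_def finite_PiE)
  also have "\<dots> = n * n ^ (k - 1)" using k1 by (simp add: tuples_def card_PiE power_eq_if)
  finally have "(s - 1) * n ^ (k - 1) < n * n ^ (k - 1)"
    by (simp only: card_F Suc_eq_plus1[symmetric] Suc_le_eq)
  then have "s - 1 < n" by (metis mult_less_cancel2)
  then show "r \<le> real n - 1" using r_eq by linarith
qed

lemma pnr: "4 * p * real n * r \<le> 1"
proof -
  have "0 < 4 * real n * r" using r_bounds n8 by simp
  moreover have "p \<le> 1 / (4 * real n * r)" using p_le by (simp only: r_eq)
  ultimately have "p * (4 * real n * r) \<le> 1" by (simp only: pos_le_divide_eq)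
  then show ?thesis by (simp only: mult_ac)
qed

lemma pn: "8 * p * real n \<le> 1"
proof -
  have "(4 * p * real n) * 2 \<le> (4 * p * real n) * r"
    using r_bounds p_nonneg by (intro mult_left_mono) auto
  with pnr show ?thesis by linarith
qed

lemma n_2p: "real n * (2 * p) \<le> 1 / 4"
  using pn by (simp add: mult_ac)

lemma p_small: "p < 1 / 8" "2 * p < 1 / 2"
proof -
  have "8 * p * 8 \<le> 8 * p * real n" using n8 p_nonneg by (intro mult_left_mono) auto
  with pn show "p < 1 / 8" "2 * p < 1 / 2" by linarith+
qed

lemma r_gap: "r * (real n - r) \<ge> real n - 1"
proof -
  \<comment> \<open>\<open>r * (n - r)\<close> is concave in \<open>r\<close> and equals
    \<open>n - 1\<close> at both \<open>r = 1\<close> and \<open>r = n - 1\<close>; this product is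
    the difference.\<close>
  have "(r - 1) * (real n - 1 - r) \<ge> 0" using r_bounds by (intro mult_nonneg_nonneg) auto
  then show ?thesis by (simp add: algebra_simps)
qed

lemma inverse_N: "1 / real n ^ (k - 1) \<le> 1 / real n" "0 \<le> 1 / real n ^ (k - 1)"
proof -
  have "real n ^ 1 \<le> real n ^ (k - 1)" using n1 k2 by (intro power_increasing) auto
  then show "1 / real n ^ (k - 1) \<le> 1 / real n" using n1 by (intro divide_left_mono) auto
qed simp

lemma inverse_n: "1 / real n \<le> 1 / 8" using n8 by (intro divide_left_mono) auto

lemma dens_bounds: "0 \<le> dens i a" "dens i a \<le> 1"
proof -
  show "0 \<le> dens i a" unfolding dens_def by (rule avg_nonneg) (simp add: f_def)
  have "dens i a \<le> avg ({1..k} - {i} \<rightarrow>\<^sub>E {1..n}) (\<lambda>_. 1)"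
    unfolding dens_def by (rule avg_mono) (simp add: f_def)
  then show "dens i a \<le> 1" using cube_ne[of "{1..k} - {i}"] by (simp add: avg_const)
qed

text \<open>One fat slice excludes nearly equal slices, whose densities would add up to at least
  \<open>n - 1/2 > r + 1/8\<close>. Otherwise every slice is within \<open>2 * p\<close> of 0 or 1.
  The total rounding error is at most \<open>n * (2 * p) \<le> 1/4\<close> and the densities sum to
  \<open>r\<close> plus at most \<open>1/8\<close>, so the number of fat slices is the integer
  \<open>r\<close>.\<close>

lemma fat_count:
  assumes i: "i \<in> {1..k}" and a0: "a0 \<in> {1..n}" "dens i a0 \<ge> 1 - 2 * p"
  shows "card {a \<in> {1..n}. dens i a \<ge> 1 - 2 * p} = s - 1"
proof -
  let ?B = "{a \<in> {1..n}. dens i a \<ge> 1 - 2 * p}"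
  have sum: "(\<Sum>a\<in>{1..n}. dens i a) = r + 1 / real n ^ (k - 1)"
    unfolding r_def by (rule sum_dens[OF i])
  have "\<forall>a\<in>{1..n}. dens i a \<ge> 1 - 2 * p \<or> dens i a \<le> 2 * p"
    using dens_dichotomy[OF _ p_small(1) i]
  proof
    assume *: "\<forall>a\<in>{1..n}. \<forall>b\<in>{1..n}.
      avg ({1..k} - {i} \<rightarrow>\<^sub>E {1..n}) (\<lambda>v. \<bar>f (v(i := a)) - f (v(i := b))\<bar>) \<le> 2 * p"
    have "1 - 4 * p \<le> dens i a" if "a \<in> {1..n}" for a
    proof -
      have "dens i a0 - dens i a
          \<le> avg ({1..k} - {i} \<rightarrow>\<^sub>E {1..n}) (\<lambda>v. \<bar>f (v(i := a0)) - f (v(i := a))\<bar>)"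
        using avg_mono[of "{1..k} - {i} \<rightarrow>\<^sub>E {1..n}" "\<lambda>v. f (v(i := a0)) - f (v(i := a))"
            "\<lambda>v. \<bar>f (v(i := a0)) - f (v(i := a))\<bar>"] by (simp add: dens_def avg_diff)
      also have "\<dots> \<le> 2 * p" using * a0(1) that by blast
      finally show ?thesis using a0(2) by simp
    qed
    then have "(\<Sum>a\<in>{1..n}. 1 - 4 * p) \<le> (\<Sum>a\<in>{1..n}. dens i a)" by (rule sum_mono)
    then have "real n - 4 * p * real n \<le> r + 1 / real n ^ (k - 1)"
      by (simp only: sum) (simp add: algebra_simps)
    then have False using pn r_bounds inverse_N inverse_n by linarith
    then show ?thesis ..
  qed (use n8 in auto)
  then have dich: "dens i a \<le> 2 * p" if "a \<in> {1..n} - ?B" for a using that by blast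
  have split: "(\<Sum>a\<in>{1..n}. dens i a) = (\<Sum>a\<in>?B. dens i a) + (\<Sum>a\<in>{1..n} - ?B. dens i a)"
    by (rule sum.subset_diff[THEN trans, OF _ _ add.commute]) auto
  have "(\<Sum>a\<in>?B. 1 - 2 * p) \<le> (\<Sum>a\<in>?B. dens i a)" by (rule sum_mono) simp
  moreover have "0 \<le> (\<Sum>a\<in>{1..n} - ?B. dens i a)" by (intro sum_nonneg dens_bounds)
  ultimately have lo: "real (card ?B) * (1 - 2 * p) \<le> r + 1 / real n ^ (k - 1)"
    using sum split by simp
  have "(\<Sum>a\<in>?B. dens i a) \<le> (\<Sum>a\<in>?B. 1)" by (intro sum_mono dens_bounds)
  moreover have "(\<Sum>a\<in>{1..n} - ?B. dens i a) \<le> (\<Sum>a\<in>{1..n} - ?B. 2 * p)"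
    by (rule sum_mono) (rule dich)
  moreover have "(\<Sum>a\<in>{1..n} - ?B. 2 * p) \<le> real n * (2 * p)"
  proof -
    have "card ({1..n} - ?B) \<le> card {1..n}" by (intro card_mono) auto
    then have "card ({1..n} - ?B) \<le> n" by simp
    then show ?thesis using p_nonneg by (simp add: mult_right_mono)
  qed
  ultimately have hi: "r + 1 / real n ^ (k - 1) \<le> real (card ?B) + real n * (2 * p)"
    using sum split by simp
  have "card ?B \<le> card {1..n}" by (intro card_mono) auto
  then have "card ?B \<le> n" by simp
  then have "real (card ?B) * (2 * p) \<le> real n * (2 * p)"
    using p_nonneg by (intro mult_right_mono) auto
  moreover have "real (card ?B) * (1 - 2 * p) = real (card ?B) - real (card ?B) * (2 * p)"
    by (simp add: right_diff_distrib)
  ultimately have "real (card ?B) < r + 1" "r < real (card ?B) + 1"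
    using lo hi n_2p inverse_N inverse_n by linarith+
  then show ?thesis unfolding r_def by linarith
qed

text \<open>Fat slices in two directions would give two slabs of \<open>r\<close> slices each, both
  of density \<open>\<phi> = r / n\<close> and almost filled by the family, but overlapping only in
  density \<open>\<phi> * \<phi>\<close>. Inclusion-exclusion then asks for more than the family
  contains: it yields \<open>r * (n - r) \<le> 2\<close>, against \<open>r_gap\<close>.\<close>

lemma fat_parallel:
  assumes i: "i \<in> {1..k}" "a \<in> {1..n}" "dens i a \<ge> 1 - 2 * p"
    and j: "j \<in> {1..k}" "b \<in> {1..n}" "dens j b \<ge> 1 - 2 * p"
  shows "i = j"
proof (rule ccontr)
  assume ne: "i \<noteq> j"
  define B where "B i = {a \<in> {1..n}. dens i a \<ge> 1 - 2 * p}" for i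
  define \<phi> where "\<phi> = r / real n"
  let ?X = "{1..k} \<rightarrow>\<^sub>E {1..n}"
  have card_B: "real (card (B i)) = r" "real (card (B j)) = r"
    using fat_count[OF i] fat_count[OF j] by (simp_all only: B_def r_def)
  have avg_B: "avg {1..n} (\<lambda>a. of_bool (a \<in> B l)) = real (card (B l)) / real n" for l
    by (simp add: avg_def of_bool_def sum.If_cases B_def Int_def)
  have slice: "avg ?X (\<lambda>x. of_bool (x l \<in> B l) * f x) \<ge> (1 - 2 * p) * \<phi>"
    if l: "l \<in> {1..k}" "real (card (B l)) = r" for l
  proof -
    have K: "insert l ({1..k} - {l}) = {1..k}" using l by auto
    have "(1 - 2 * p) * \<phi> = avg {1..n} (\<lambda>a. of_bool (a \<in> B l) * (1 - 2 * p))"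
      by (simp only: avg_multc avg_B l(2) \<phi>_def mult.commute)
    also have "\<dots> \<le> avg {1..n} (\<lambda>a. of_bool (a \<in> B l) * dens l a)"
      by (rule avg_mono) (auto simp: B_def)
    also have "\<dots> = avg ?X (\<lambda>x. of_bool (x l \<in> B l) * f x)"
      using avg_PiE_insert[of l "{1..k} - {l}" "{1..n}" "\<lambda>x. of_bool (x l \<in> B l) * f x"]
      unfolding K by (simp add: dens_def avg_cmult)
    finally show ?thesis .
  qed
  have both: "avg ?X (\<lambda>x. of_bool (x i \<in> B i) * of_bool (x j \<in> B j)) = \<phi> * \<phi>"
  proof -
    have K: "insert i (insert j ({1..k} - {i, j})) = {1..k}" using i j by auto
    have notin: "i \<notin> insert j ({1..k} - {i, j})" "j \<notin> {1..k} - {i, j}" using ne by auto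
    have "avg (insert i (insert j ({1..k} - {i, j})) \<rightarrow>\<^sub>E {1..n})
        (\<lambda>x. of_bool (x i \<in> B i) * of_bool (x j \<in> B j))
      = avg {1..n} (\<lambda>a. avg {1..n} (\<lambda>b. avg ({1..k} - {i, j} \<rightarrow>\<^sub>E {1..n})
          (\<lambda>v. of_bool (a \<in> B i) * of_bool (b \<in> B j))))"
      unfolding avg_PiE_insert[OF notin(1)] avg_PiE_insert[OF notin(2)] using ne by simp
    also have "\<dots> = avg {1..n} (\<lambda>a. of_bool (a \<in> B i) * avg {1..n} (\<lambda>b. of_bool (b \<in> B j)))"
      using cube_ne[of "{1..k} - {i, j}"] by (simp add: avg_const avg_cmult)
    also have "\<dots> = \<phi> * \<phi>" by (simp only: avg_multc avg_B card_B \<phi>_def)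
    finally show ?thesis unfolding K .
  qed
  \<comment> \<open>Pointwise inclusion-exclusion: on the overlap of the slabs the left side is
    \<open>2 * f x - 1 \<le> f x\<close>.\<close>
  have "avg ?X (\<lambda>x. of_bool (x i \<in> B i) * f x + of_bool (x j \<in> B j) * f x
      - of_bool (x i \<in> B i) * of_bool (x j \<in> B j)) \<le> avg ?X f"
    by (rule avg_mono) (auto simp: f_def)
  then have "2 * ((1 - 2 * p) * \<phi>) - \<phi> * \<phi> \<le> r / real n + 1 / real n ^ k"
    unfolding avg_add avg_diff both avg_f[folded r_def]
    using slice[OF i(1) card_B(1)] slice[OF j(1) card_B(2)] by linarith
  then have "real n * (2 * ((1 - 2 * p) * \<phi>) - \<phi> * \<phi>) \<le> real n * (r / real n + 1 / real n ^ k)"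
    by (intro mult_left_mono) auto
  also have "real n ^ k = real n * real n ^ (k - 1)" using k1 by (simp add: power_eq_if)
  also have "real n * (r / real n + 1 / (real n * real n ^ (k - 1))) = r + 1 / real n ^ (k - 1)"
    using n1 by (simp add: distrib_left)
  also have "\<dots> \<le> r + 1 / real n" using inverse_N by simp
  finally have "real n * (2 * ((1 - 2 * p) * \<phi>) - \<phi> * \<phi>) \<le> r + 1 / real n" .
  then have "real n * (real n * (2 * ((1 - 2 * p) * \<phi>) - \<phi> * \<phi>)) \<le> real n * (r + 1 / real n)"
    by (intro mult_left_mono) auto
  moreover have "real n * (real n * (2 * ((1 - 2 * p) * \<phi>) - \<phi> * \<phi>))
      = 2 * ((1 - 2 * p) * (real n * r)) - r * r"
  proof -
    have nphi: "real n * \<phi> = r" using n1 by (simp add: \<phi>_def)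
    have "real n * (real n * (2 * ((1 - 2 * p) * \<phi>) - \<phi> * \<phi>))
        = 2 * ((1 - 2 * p) * (real n * (real n * \<phi>))) - (real n * \<phi>) * (real n * \<phi>)"
      by (simp add: algebra_simps)
    then show ?thesis by (simp only: nphi)
  qed
  moreover have "real n * (r + 1 / real n) = real n * r + 1" using n1 by (simp add: distrib_left)
  ultimately have "2 * ((1 - 2 * p) * (real n * r)) - r * r \<le> real n * r + 1" by simp
  then have "r * (real n - r) \<le> 1 + 4 * p * real n * r" by (simp add: algebra_simps)
  with pnr r_gap n8 show False by simp
qed

section \<open>Existence of a fat hyperplane by interpolation over the coordinates\<close>

text \<open>Bounds an interpolation step \<open>2 * p\<close> by a sixth of the peak of the tent. By
  \<open>pnr\<close> it reduces to \<open>3 * n \<le> r * r * (n - r)\<close>, which is sharp at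
  \<open>r = 2\<close>, \<open>n = 8\<close>.\<close>

lemma peak_bound: "12 * p \<le> r / real n * (1 - r / real n)"
proof -
  have "3 * real n \<le> r * (r * (real n - r))"
  proof -
    \<comment> \<open>For \<open>r = 2\<close> and \<open>r = 3\<close> the bound
      \<open>r_gap\<close> is too weak, so these values are inserted directly.\<close>
    consider "s - 1 = 2" | "s - 1 = 3" | "4 \<le> s - 1" using s3 by linarith
    then show ?thesis
    proof cases
      case 1
      then have "r = 2" by (simp only: r_def)
      then show ?thesis using n8 by simp
    next
      case 2
      then have "r = 3" by (simp only: r_def)
      then show ?thesis using n8 by simp
    next
      case 3
      then have "4 \<le> r" unfolding r_def by linarith
      then have "4 * (real n - 1) \<le> r * (r * (real n - r))"
        using r_gap n8 by (intro mult_mono) auto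
      then show ?thesis using n8 by simp
    qed
  qed
  moreover have "3 * real n * (4 * p * real n * r) \<le> 3 * real n * 1"
    using pnr by (intro mult_left_mono) auto
  ultimately have "r * (12 * p * (real n * real n)) \<le> r * (r * (real n - r))" by (simp add: mult_ac)
  then have "12 * p * (real n * real n) \<le> r * (real n - r)" using r_bounds by simp
  moreover have "r / real n * (1 - r / real n) = r * (real n - r) / (real n * real n)"
    using n1 by (simp add: field_simps)
  moreover have "0 < real n * real n" using n1 by simp
  ultimately show ?thesis by (simp only: pos_le_divide_eq)
qed

text \<open>Without fat hyperplanes, \<open>E l\<close> moves from nearly \<open>W\<close> at
  \<open>l = 0\<close> to 0 at \<open>l = k\<close> in steps of at most \<open>W / 6\<close>, so
  some value falls into the middle window; there \<open>split_balance_le\<close> would require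
  \<open>3/4 * 35/144 = 35/192 \<le> 1/6\<close>.\<close>

lemma exists_fat: "\<exists>i\<in>{1..k}. \<exists>a\<in>{1..n}. dens i a \<ge> 1 - 2 * p"
proof (rule ccontr)
  assume none: "\<not> ?thesis"
  define \<phi> where "\<phi> = r / real n"
  define W where "W = \<phi> * (1 - \<phi>)"
  have \<phi>: "0 < \<phi>" "\<phi> \<le> 1 - 1 / real n" "\<phi> \<le> 1"
    using r_bounds n8 by (auto simp: \<phi>_def field_simps)
  have "0 < 1 / real n" using n1 by simp
  then have "0 < 1 - \<phi>" using \<phi> by linarith
  then have W: "0 < W" "12 * p \<le> W"
    using \<phi>(1) peak_bound by (simp_all add: W_def \<phi>_def[symmetric])
  have low_influence: "avg ({1..k} - {i} \<rightarrow>\<^sub>E {1..n}) (\<lambda>v. \<bar>f (v(i := a)) - f (v(i := b))\<bar>) \<le> 2 * p"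
    if i: "i \<in> {1..k}" and ab: "a \<in> {1..n}" "b \<in> {1..n}" for i a b
  proof -
    \<comment> \<open>Otherwise, with no fat slice, every slice in direction \<open>i\<close> is
      thin and the densities sum to at most \<open>1/4\<close>, less than \<open>r\<close>.\<close>
    have "\<not> (\<forall>a\<in>{1..n}. dens i a \<ge> 1 - 2 * p \<or> dens i a \<le> 2 * p)"
    proof
      assume "\<forall>a\<in>{1..n}. dens i a \<ge> 1 - 2 * p \<or> dens i a \<le> 2 * p"
      then have "dens i a \<le> 2 * p" if "a \<in> {1..n}" for a using none i that by blast
      then have "(\<Sum>a\<in>{1..n}. dens i a) \<le> (\<Sum>a\<in>{1..n}. 2 * p)" by (rule sum_mono)
      then have "r + 1 / real n ^ (k - 1) \<le> real n * (2 * p)"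
        unfolding sum_dens[OF i, folded r_def] by simp
      then show False using n_2p r_bounds inverse_N by linarith
    qed
    then show ?thesis using dens_dichotomy[OF _ p_small(1) i] n8 ab by fastforce
  qed
  define E where "E l = avg ({1..l} \<rightarrow>\<^sub>E {1..n})
    (\<lambda>u. tent \<phi> (avg ({l+1..k} \<rightarrow>\<^sub>E {1..n}) (\<lambda>v. f (join {1..l} u v))))" for l
  \<comment> \<open>The density of the whole family exceeds the peak \<open>\<phi>\<close> by
    \<open>1 / n ^ k\<close>. Past the peak the tent falls with slope \<open>\<phi>\<close>, and the
    loss is at most \<open>W / 8\<close> because \<open>1 / n \<le> 1 - \<phi>\<close>.\<close>
  have E0: "7 / 12 * W < E 0"
  proof -
    have "E 0 = tent \<phi> (\<phi> + 1 / real n ^ k)"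
      by (simp add: E_def avg_def[of "{\<lambda>x. undefined}"] avg_f[unfolded One_nat_def, folded r_def[unfolded One_nat_def]] \<phi>_def)
    also have "\<dots> \<ge> W - 1 / real n ^ k * \<phi>"
      using \<phi> by (auto simp: tent_def W_def min_def algebra_simps)
    finally have "W - 1 / real n ^ k * \<phi> \<le> E 0" .
    moreover have "1 / real n ^ k * \<phi> \<le> 1 / 8 * (1 - \<phi>) * \<phi>"
    proof (rule mult_right_mono)
      have "1 / real n ^ k = 1 / real n ^ (k - 1) * (1 / real n)"
        using k1 by (simp add: power_eq_if)
      also have "\<dots> \<le> 1 / 8 * (1 - \<phi>)"
        using inverse_N inverse_n \<phi> by (intro mult_mono) auto
      finally show "1 / real n ^ k \<le> 1 / 8 * (1 - \<phi>)" .
    qed (use \<phi> in auto)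
    ultimately show ?thesis using W by (simp add: W_def algebra_simps)
  qed
  have Ek: "E k = 0"
  proof -
    have "tent \<phi> (f x) = 0" for x using f01[of x] \<phi> by (auto simp: tent_def)
    then show ?thesis by (simp add: E_def avg_def)
  qed
  have step: "\<bar>E (Suc l) - E l\<bar> \<le> 2 * p" if "l < k" for l
  proof -
    have sets: "{1..Suc l} = insert (Suc l) {1..l}" "{l+1..k} = insert (Suc l) {Suc l + 1..k}"
      "{1..l} \<union> {Suc l + 1..k} = {1..k} - {Suc l}" using that by auto
    have "\<bar>E (Suc l) - E l\<bar> \<le> 2 * p"
      unfolding E_def sets(1,2)
    proof (rule tent_split_step)
      fix a b assume "a \<in> {1..n}" "b \<in> {1..n}"
      then show "avg ({1..l} \<union> {Suc l + 1..k} \<rightarrow>\<^sub>E {1..n})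
          (\<lambda>w. \<bar>f (w(Suc l := a)) - f (w(Suc l := b))\<bar>) \<le> 2 * p"
        unfolding sets(3) using that by (intro low_influence) auto
    qed (use \<phi> n1 in auto)
    then show ?thesis .
  qed
  \<comment> \<open>The steps have size at most \<open>W / 6\<close>, so the first \<open>E m\<close> below \<open>7 / 12 * W\<close> is at least \<open>5 / 12 * W\<close>.\<close>
  define m where "m = (LEAST l. E l \<le> 7 / 12 * W)"
  have "E k \<le> 7 / 12 * W" using Ek W by simp
  then have Em: "E m \<le> 7 / 12 * W" and mk: "m \<le> k"
    unfolding m_def by (rule LeastI, rule Least_le)
  have "m \<noteq> 0" using Em E0 by (metis not_less)
  then obtain l where l: "m = Suc l" by (cases m) auto
  have "\<not> E l \<le> 7 / 12 * W" using not_less_Least[of l "\<lambda>l. E l \<le> 7 / 12 * W"] l by (simp add: m_def)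
  then have Em': "5 / 12 * W \<le> E m" using step[of l] mk l W by auto
  \<comment> \<open>On the window from \<open>5/12 * W\<close> to \<open>7/12 * W\<close> the
    product \<open>x * (W - x)\<close> is smallest at the ends.\<close>
  have "0 \<le> (E m - 5 / 12 * W) * (7 / 12 * W - E m)" using Em Em' by (intro mult_nonneg_nonneg) auto
  then have E1: "35 / 144 * (W * W) \<le> E m * (W - E m)" by (simp add: field_simps)
  have U: "{1..m} \<union> {m+1..k} = {1..k}" using mk by auto
  have c: "real (card {1..n}) = real n" by simp
  have "(1 - 2 / real n) * (E m * (W - E m)) \<le> 2 * p * W"
    unfolding E_def W_def \<phi>_def p_eq[folded r_def]
    by (rule split_balance_le[of "{1..m}" "{m+1..k}" "{1..n}" f r, unfolded U c])
      (use n8 f01 r_bounds in auto)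
  moreover have "3 / 4 * (35 / 144 * (W * W)) \<le> (1 - 2 / real n) * (E m * (W - E m))"
  proof (rule mult_mono[OF _ E1])
    show "3 / 4 \<le> 1 - 2 / real n" "0 \<le> 1 - 2 / real n" using n8 by (simp_all add: field_simps)
  qed (use W in simp)
  moreover have "2 * p * W \<le> 1 / 6 * W * W" using W by (intro mult_right_mono) auto
  moreover have "0 < W * W" using W by simp
  ultimately show False by simp
qed

lemma fat_hyperplanes_parallel:
  "\<exists>i\<in>{1..k}. \<forall>H\<in>hyperplanes n k. fat n k s \<F> H \<longrightarrow> (\<exists>a\<in>{1..n}. H = hyperplane n k i a)"
proof -
  obtain i a where i: "i \<in> {1..k}" "a \<in> {1..n}" "dens i a \<ge> 1 - 2 * p" using exists_fat by blast
  show ?thesis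
  proof (intro bexI[OF _ i(1)] ballI impI)
    fix H assume H: "H \<in> hyperplanes n k" "fat n k s \<F> H"
    then obtain j b where j: "j \<in> {1..k}" "b \<in> {1..n}" "H = hyperplane n k j b"
      by (auto simp: hyperplanes_def)
    then have "i = j" using fat_parallel[OF i j(1,2)] H(2) fat_iff[OF j(1,2)] by simp
    with j show "\<exists>a\<in>{1..n}. H = hyperplane n k i a" by blast
  qed
qed

lemma card_fat_hyperplanes: "card {H \<in> hyperplanes n k. fat n k s \<F> H} = s - 1"
proof -
  obtain i a where i: "i \<in> {1..k}" "a \<in> {1..n}" "dens i a \<ge> 1 - 2 * p" using exists_fat by blast
  let ?B = "{a \<in> {1..n}. dens i a \<ge> 1 - 2 * p}"
  have "{H \<in> hyperplanes n k. fat n k s \<F> H} = hyperplane n k i ` ?B"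
  proof (intro equalityI subsetI)
    fix H assume "H \<in> {H \<in> hyperplanes n k. fat n k s \<F> H}"
    then obtain j b where j: "j \<in> {1..k}" "b \<in> {1..n}" "H = hyperplane n k j b" "fat n k s \<F> H"
      by (auto simp: hyperplanes_def)
    then have b: "dens j b \<ge> 1 - 2 * p" using fat_iff[OF j(1,2)] by simp
    have "i = j" by (rule fat_parallel[OF i j(1,2) b])
    with j b show "H \<in> hyperplane n k i ` ?B" by blast
  next
    fix H assume "H \<in> hyperplane n k i ` ?B"
    then obtain b where b: "b \<in> {1..n}" "dens i b \<ge> 1 - 2 * p" "H = hyperplane n k i b" by blast
    then show "H \<in> {H \<in> hyperplanes n k. fat n k s \<F> H}"
      using i(1) fat_iff[OF i(1) b(1)] by (auto simp: hyperplanes_def)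
  qed
  \<comment> \<open>Fat hyperplanes are counted as sets, so different slices must be different sets;
    a constant tuple tells them apart.\<close>
  moreover have "inj_on (hyperplane n k i) ?B"
  proof (rule inj_onI)
    fix a b assume ab: "a \<in> ?B" "b \<in> ?B" "hyperplane n k i a = hyperplane n k i b"
    have "(\<lambda>j\<in>{1..k}. a) \<in> hyperplane n k i a"
      using ab(1) i(1) by (auto simp: hyperplane_def tuples_def)
    then have "(\<lambda>j\<in>{1..k}. a) \<in> hyperplane n k i b" by (simp only: ab(3))
    then show "a = b" using i(1) by (simp add: hyperplane_def)
  qed
  ultimately show ?thesis using fat_count[OF i] by (simp add: card_image)
qed

end

theorem theorem6:
  fixes n k s :: nat and \<F> :: "(nat \<Rightarrow> nat) set"
  assumes "n \<ge> 1" and "k \<ge> 1" and "s \<ge> 1"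
    and "\<F> \<subseteq> tuples n k"
    and "card \<F> = (s - 1) * n ^ (k - 1) + 1"
  shows "(n \<ge> 4 \<and> p_fail n k s \<F> < 1 / 8 \<longrightarrow>
           (\<forall>i\<in>{1..k}.
              (\<forall>a\<in>{1..n}. real (card (hyperplane n k i a \<inter> \<F>))
                 \<le> 2 * p_fail n k s \<F> * real n ^ (k - 1) + (real s - 1) * real n powi (int k - 2))
            \<or> (\<exists>F T. {1..n} = F \<union> T \<and> F \<inter> T = {}
                 \<and> (\<forall>a\<in>F. fat n k s \<F> (hyperplane n k i a))
                 \<and> (\<forall>a\<in>T. thin n k s \<F> (hyperplane n k i a)))))
       \<and> (n \<ge> 8 \<and> s \<ge> 3 \<and> p_fail n k s \<F> \<le> 1 / (4 * real n * (real s - 1)) \<longrightarrow>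
           (\<exists>i\<in>{1..k}. \<forall>H\<in>hyperplanes n k. fat n k s \<F> H \<longrightarrow> (\<exists>a\<in>{1..n}. H = hyperplane n k i a)))
       \<and> (n \<ge> 8 \<and> s \<ge> 3 \<and> p_fail n k s \<F> \<le> 1 / (4 * real n * (real s - 1)) \<longrightarrow>
           card {H \<in> hyperplanes n k. fat n k s \<F> H} = s - 1)"
proof -
  interpret matching_family n k s \<F> using assms by unfold_locales
  have small: "small_failure n k s \<F>"
    if "n \<ge> 8 \<and> s \<ge> 3 \<and> p_fail n k s \<F> \<le> 1 / (4 * real n * (real s - 1))"
    using that by unfold_locales auto
  show ?thesis
    using dichotomy_fat_thin small_failure.fat_hyperplanes_parallel[OF small]
      small_failure.card_fat_hyperplanes[OF small]
    by (intro conjI impI ballI) blast+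
qed

end
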